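(* There exists an invertible operator (i.e. a bijection) $\mathcal{G}:\mathcal{P}\to\mathcal{P}$ such that, for every $h,k\in\mathcal{P}$, $$\left(\int_0^1 h(t)\,dt\right)^2 \mu_1(h)=\sigma_1\left(\mathcal{G}(h)\right)$$ and $$\left(\int_0^1 \frac{1}{\sqrt{k(t)}}\,dt\right)^{2}\sigma_1(k)=\mu_1\left(\mathcal{G}^{-1}(k)\right).$$
   Context: Let $\mathcal{P}$ be the set of functions $h\in L^\infty(0,1)$ that are non-negative, concave and not identically zero (each such $h$ is identified with its continuous representative on $[0,1]$). For $h\in\mathcal{P}$ define $$\mu_1(h)=\inf\left\{\frac{\int_0^1 (u')^2 h\,dx}{\int_0^1 u^2 h\,dx} : u\in H^1(0,1),\ u\neq 0,\ \int_0^1 u h\,dx=0\right\},$$ $$\sigma_1(h)=\inf\left\{\frac{\int_0^1 (v')^2 h\,dx}{\int_0^1 v^2\,dx} : v\in H^1(0,1),\ v\neq 0,\ \int_0^1 v\,dx=0\right\}.$$ These are the first non-zero eigenvalues of the Sturm–Liouville problems $-(h v')'=\mu h v$ and $-(hv')'=\sigma v$ in $(0,1)$, respectively, both with boundary conditions $h(0)v'(0)=h(1)v'(1)=0$. *)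

theory Defs
  imports "HOL-Analysis.Analysis"
begin

abbreviation unit_leb :: "real measure"
  where "unit_leb \<equiv> lebesgue_on {0<..<1}"

text \<open>
  Elements of \<open>L\<^sup>2(0,1)\<close> and \<open>H\<^sup>1(0,1)\<close> are represented by functions, not by
  classes modulo null sets; accordingly ``nonzero'' means ``not almost everywhere zero''.
\<close>

definition L2_unit :: "(real \<Rightarrow> real) set"
  where "L2_unit = {u \<in> borel_measurable unit_leb. integrable unit_leb (\<lambda>x. (u x)\<^sup>2)}"

text \<open>
  The test functions \<open>C\<^sub>c\<^sup>\<infinity>(0,1)\<close>, extended by zero to the real line; the closed support
  below is automatically compact.
\<close>

definition test_functions :: "(real \<Rightarrow> real) set"
  where "test_functions =
    {\<phi>. (\<forall>n. (deriv ^^ n) \<phi> differentiable_on UNIV) \<and> closure {x. \<phi> x \<noteq> 0} \<subseteq> {0<..<1}}"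

definition weak_deriv :: "(real \<Rightarrow> real) \<Rightarrow> (real \<Rightarrow> real) \<Rightarrow> bool"
  where "weak_deriv u u' \<longleftrightarrow>
    (\<forall>\<phi>\<in>test_functions.
       (LINT x|unit_leb. u x * deriv \<phi> x) = - (LINT x|unit_leb. u' x * \<phi> x))"

text \<open>
  The set of pairs of a function \<open>u\<close> in \<open>H\<^sup>1(0,1)\<close> and a version \<open>u'\<close> of its weak
  derivative. As \<open>u'\<close> is unique up to null sets, the quotients below depend on \<open>u\<close> only.
\<close>

definition H1_unit :: "((real \<Rightarrow> real) \<times> (real \<Rightarrow> real)) set"
  where "H1_unit = {(u, u'). u \<in> L2_unit \<and> u' \<in> L2_unit \<and> weak_deriv u u'}"

text \<open>
  The bounded, non-negative, concave functions on \<open>(0,1)\<close> that are not identically zero, each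
  given by its continuous representative on \<open>[0,1]\<close>. Boundedness follows from continuity on
  the compact interval. The values outside \<open>[0,1]\<close> are fixed by extensionality, so that
  different elements of the set are different functions on \<open>[0,1]\<close>.
\<close>

definition concave_weights :: "(real \<Rightarrow> real) set"
  where "concave_weights =
    {h \<in> extensional {0..1}.
       continuous_on {0..1} h \<and> concave_on {0..1} h \<and>
       (\<forall>x\<in>{0..1}. 0 \<le> h x) \<and> (\<exists>x\<in>{0..1}. h x \<noteq> 0)}"

definition mu1 :: "(real \<Rightarrow> real) \<Rightarrow> real"
  where "mu1 h = Inf
    {(LINT x|unit_leb. (u' x)\<^sup>2 * h x) / (LINT x|unit_leb. (u x)\<^sup>2 * h x) | u u'.
       (u, u') \<in> H1_unit \<and> \<not> (AE x in unit_leb. u x = 0) \<and>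
       (LINT x|unit_leb. u x * h x) = 0}"

definition sigma1 :: "(real \<Rightarrow> real) \<Rightarrow> real"
  where "sigma1 h = Inf
    {(LINT x|unit_leb. (v' x)\<^sup>2 * h x) / (LINT x|unit_leb. (v x)\<^sup>2) | v v'.
       (v, v') \<in> H1_unit \<and> \<not> (AE x in unit_leb. v x = 0) \<and>
       (LINT x|unit_leb. v x) = 0}"

end

theory Submission
  imports Defs "HOL-Computational_Algebra.Polynomial"
begin

text \<open>
  Put \<open>M = \<integral>h\<close> and \<open>H(x) = (1/M) \<integral>\<^sub>0\<^sup>x h\<close>. A nonzero concave weight is positive inside
  the interval, so \<open>H\<close> is an increasing bijection of \<open>[0, 1]\<close> with \<open>H' = h / M\<close>. The
  operator is \<open>G h = h\<^sup>2 \<circ> H\<^sup>-\<^sup>1\<close>. Writing \<open>k = G h\<close> and substituting \<open>y = H(x)\<close>,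
  \<open>u = v \<circ> H\<close> turns \<open>\<integral>u h\<close>, \<open>\<integral>u\<^sup>2 h\<close> and \<open>\<integral>u'\<^sup>2 h\<close> into
  \<open>M \<integral>v\<close>, \<open>M \<integral>v\<^sup>2\<close> and \<open>(1/M) \<integral>v'\<^sup>2 k\<close>. The two Rayleigh quotients
  therefore differ by the factor \<open>M\<^sup>2\<close>, which is the first identity
  (\<open>transport_eigenvalues\<close>). There is one obstacle: \<open>u \<circ> H\<^sup>-\<^sup>1\<close> need not belong to
  \<open>H\<^sup>1\<close> when \<open>h\<close> vanishes at an endpoint. It is overcome by replacing \<open>u'\<close> with
  \<open>u' h / (h + e)\<close> and letting \<open>e\<close> tend to zero (\<open>sigma1_transport_regularised\<close>).

  The weight \<open>k\<close> is concave since \<open>k'(H(x)) = 2 M h'(x)\<close> is nonincreasing. Conversely a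
  concave weight \<open>k\<close> comes from \<open>h = \<surd>k \<circ> K\<^sup>-\<^sup>1\<close>, where \<open>K\<close> is the primitive of
  \<open>1 / \<surd>k\<close> divided by \<open>N = \<integral> 1 / \<surd>k\<close>, and \<open>h\<close> is concave because
  \<open>h'(K(y)) = (N/2) k'(y)\<close>. Weights need not be differentiable, so both computations are carried
  out with supergradients (\<open>concave_on_reparam\<close>). The same substitution gives \<open>N = 1 / M\<close>
  (\<open>inverse_sqrt_transported_weight\<close>), which turns the first identity into the second.

  To apply the change of variables to \<open>H\<^sup>1\<close>, its elements are identified with the primitives of
  square integrable functions. A primitive has the expected weak derivative by Fubini's theorem
  (\<open>weak_deriv_primitive\<close>); conversely a function with a weak derivative is a primitive
  by the lemma of du Bois-Reymond, which rests on explicit smooth bump functions.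
\<close>

section \<open>Smooth bump functions\<close>

text \<open>
  A bound on the order of differentiation makes closure under products provable by induction:
  the product rule involves the factors themselves next to their derivatives.
\<close>

definition differentiable_upto :: "nat \<Rightarrow> (real \<Rightarrow> real) \<Rightarrow> bool"
  where "differentiable_upto n f \<longleftrightarrow> (\<forall>i\<le>n. (deriv ^^ i) f differentiable_on UNIV)"

lemma differentiable_upto_0: "differentiable_upto 0 f \<longleftrightarrow> f differentiable_on UNIV"
  by (simp add: differentiable_upto_def)

lemma differentiable_upto_Suc:
  "differentiable_upto (Suc n) f \<longleftrightarrow> f differentiable_on UNIV \<and> differentiable_upto n (deriv f)"
proof -
  have "(\<forall>i\<le>Suc n. P i) \<longleftrightarrow> P 0 \<and> (\<forall>i\<le>n. P (Suc i))" for P :: "nat \<Rightarrow> bool"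
    by (metis Suc_le_mono not0_implies_Suc zero_le)
  from this[of "\<lambda>i. (deriv ^^ i) f differentiable_on UNIV"] show ?thesis
    by (simp add: differentiable_upto_def funpow_Suc_right del: funpow.simps)
qed

lemma differentiable_upto_mono: "differentiable_upto n f \<Longrightarrow> m \<le> n \<Longrightarrow> differentiable_upto m f"
  by (auto simp: differentiable_upto_def)

lemma DERIV_deriv_differentiable_on_UNIV:
  fixes f :: "real \<Rightarrow> real"
  assumes "f differentiable_on UNIV"
  shows "(f has_real_derivative deriv f x) (at x)"
  using assms by (simp add: DERIV_deriv_iff_real_differentiable differentiable_on_def)

lemma differentiable_on_UNIV_if_DERIV:
  fixes f :: "real \<Rightarrow> real"
  assumes "\<And>x. (f has_real_derivative g x) (at x)"
  shows "f differentiable_on UNIV"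
  using assms by (auto simp: differentiable_on_def real_differentiable_def)

lemma deriv_eqI: "(\<And>x. (f has_field_derivative g x) (at x)) \<Longrightarrow> deriv f = g"
  by (auto intro: DERIV_imp_deriv)

lemma differentiable_upto_add:
  assumes "differentiable_upto n f" "differentiable_upto n g"
  shows "differentiable_upto n (\<lambda>x. f x + g x)"
  using assms
proof (induction n arbitrary: f g)
  case 0 then show ?case by (simp add: differentiable_upto_0 differentiable_on_add)
next
  case (Suc n)
  then have d: "f differentiable_on UNIV" "g differentiable_on UNIV"
    and e: "differentiable_upto n (deriv f)" "differentiable_upto n (deriv g)"
    by (auto simp: differentiable_upto_Suc)
  have "deriv (\<lambda>x. f x + g x) = (\<lambda>x. deriv f x + deriv g x)"
    using d by (intro deriv_eqI DERIV_add DERIV_deriv_differentiable_on_UNIV)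
  with Suc.IH[OF e] d show ?case
    by (simp add: differentiable_upto_Suc differentiable_on_add)
qed

lemma differentiable_upto_cmult:
  assumes "differentiable_upto n f"
  shows "differentiable_upto n (\<lambda>x. c * f x)"
  using assms
proof (induction n arbitrary: f)
  case 0 then show ?case by (simp add: differentiable_upto_0 differentiable_on_mult)
next
  case (Suc n)
  then have d: "f differentiable_on UNIV" and e: "differentiable_upto n (deriv f)"
    by (auto simp: differentiable_upto_Suc)
  have "deriv (\<lambda>x. c * f x) = (\<lambda>x. c * deriv f x)"
    using d by (intro deriv_eqI DERIV_cmult DERIV_deriv_differentiable_on_UNIV)
  with Suc.IH[OF e] d show ?case
    by (simp add: differentiable_upto_Suc differentiable_on_mult)
qed

lemma differentiable_upto_mult:
  assumes "differentiable_upto n f" "differentiable_upto n g"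
  shows "differentiable_upto n (\<lambda>x. f x * g x)"
  using assms
proof (induction n arbitrary: f g)
  case 0 then show ?case by (simp add: differentiable_upto_0 differentiable_on_mult)
next
  case (Suc n)
  then have d: "f differentiable_on UNIV" "g differentiable_on UNIV"
    and e: "differentiable_upto n (deriv f)" "differentiable_upto n (deriv g)"
    by (auto simp: differentiable_upto_Suc)
  have u: "differentiable_upto n f" "differentiable_upto n g"
    using Suc.prems by (auto elim: differentiable_upto_mono)
  have "deriv (\<lambda>x. f x * g x) = (\<lambda>x. deriv f x * g x + f x * deriv g x)"
    using DERIV_mult[OF d[THEN DERIV_deriv_differentiable_on_UNIV]]
    by (intro deriv_eqI) (simp add: algebra_simps)
  with Suc.IH[OF e(1) u(2)] Suc.IH[OF u(1) e(2)] d show ?case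
    by (simp add: differentiable_upto_Suc differentiable_on_mult differentiable_upto_add)
qed

lemma differentiable_upto_affine:
  assumes "differentiable_upto n f"
  shows "differentiable_upto n (\<lambda>x. f (a * x + b))"
  using assms
proof (induction n arbitrary: f)
  have D: "((\<lambda>x. f (a * x + b)) has_real_derivative a * deriv f (a * x + b)) (at x)"
    if "f differentiable_on UNIV" for f x
  proof -
    have "((\<lambda>x. a * x + b) has_real_derivative a) (at x)"
      by (auto intro!: derivative_eq_intros)
    from DERIV_chain2[OF DERIV_deriv_differentiable_on_UNIV[OF that] this] show ?thesis
      by (simp add: mult.commute)
  qed
  {
    case 0 then show ?case
      using differentiable_on_UNIV_if_DERIV[OF D] by (simp add: differentiable_upto_0)
  next
    case (Suc n)
    then have d: "f differentiable_on UNIV" and e: "differentiable_upto n (deriv f)"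
      by (auto simp: differentiable_upto_Suc)
    have "deriv (\<lambda>x. f (a * x + b)) = (\<lambda>x. a * deriv f (a * x + b))"
      using D[OF d] by (rule deriv_eqI)
    with differentiable_upto_cmult[OF Suc.IH[OF e]] differentiable_on_UNIV_if_DERIV[OF D[OF d]]
    show ?case by (simp add: differentiable_upto_Suc)
  }
qed

text \<open>
  For \<open>p = 1\<close> this is the classical smooth function that vanishes to infinite order at the
  origin. The polynomial factor makes the family closed under differentiation, so that a single
  derivative computation gives derivatives of all orders.
\<close>

definition flat_exp :: "real poly \<Rightarrow> real \<Rightarrow> real"
  where "flat_exp p x = (if 0 < x then poly p (1 / x) * exp (- (1 / x)) else 0)"

lemma poly_times_exp_minus_tendsto_0:
  "((\<lambda>t::real. poly p t * exp (- t)) \<longlongrightarrow> 0) at_top"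
proof -
  have "((\<lambda>t::real. \<Sum>i\<le>degree p. coeff p i * (t ^ i / exp t)) \<longlongrightarrow> (\<Sum>i\<le>degree p. coeff p i * 0)) at_top"
    by (intro tendsto_intros tendsto_power_div_exp_0)
  moreover have "(\<Sum>i\<le>degree p. coeff p i * (t ^ i / exp t)) = poly p t * exp (- t)" for t :: real
    by (simp add: poly_altdef sum_distrib_right exp_minus divide_inverse mult.assoc)
  ultimately show ?thesis by simp
qed

text \<open>
  Off the origin this is the product rule: with \<open>t = 1/x\<close>, differentiation turns
  \<open>p(t) exp(-t)\<close> into \<open>t\<^sup>2 (p(t) - p'(t)) exp(-t)\<close>. At the origin the right-hand
  difference quotient is \<open>t p(t) exp(-t)\<close>, which vanishes as \<open>t\<close> tends to infinity.
\<close>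

lemma flat_exp_has_derivative:
  "(flat_exp p has_real_derivative flat_exp (monom 1 2 * (p - pderiv p)) x) (at x)"
proof -
  consider "x > 0" | "x < 0" | "x = 0" by linarith
  then show ?thesis
  proof cases
    case 1
    have "((\<lambda>x. poly p (1 / x) * exp (- (1 / x))) has_real_derivative
        flat_exp (monom 1 2 * (p - pderiv p)) x) (at x)"
      using 1
      by (auto intro!: derivative_eq_intros DERIV_chain2[OF poly_DERIV]
          simp: flat_exp_def poly_monom power2_eq_square field_simps)
    then show ?thesis
      by (rule has_field_derivative_transform_within_open[where S="{0<..}"])
         (use 1 in \<open>auto simp: flat_exp_def\<close>)
  next
    case 2
    have "((\<lambda>x. 0) has_real_derivative flat_exp (monom 1 2 * (p - pderiv p)) x) (at x)"
      using 2 by (simp add: flat_exp_def)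
    then show ?thesis
      by (rule has_field_derivative_transform_within_open[where S="{..<0}"])
         (use 2 in \<open>auto simp: flat_exp_def\<close>)
  next
    case 3
    have R: "((\<lambda>h. flat_exp p h / h) \<longlongrightarrow> 0) (at_right 0)"
    proof -
      have "((\<lambda>h. poly (monom 1 1 * p) (inverse h) * exp (- inverse h)) \<longlongrightarrow> 0) (at_right (0::real))"
        by (rule filterlim_compose[OF poly_times_exp_minus_tendsto_0 filterlim_inverse_at_top_right])
      then show ?thesis
        by (rule Lim_transform_eventually)
           (auto simp: eventually_at_right_less flat_exp_def poly_monom field_simps
              intro!: eventually_mono[OF eventually_at_right_less[of 0]])
    qed
    have L: "((\<lambda>h. flat_exp p h / h) \<longlongrightarrow> 0) (at_left 0)"
      by (rule Lim_transform_eventually[OF tendsto_const])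
         (auto simp: flat_exp_def eventually_at_left_field intro!: exI[of _ "-1"])
    have "((\<lambda>h. flat_exp p h / h) \<longlongrightarrow> 0) (at 0)"
      using L R by (simp add: filterlim_split_at)
    then show ?thesis using 3
      by (simp add: DERIV_def flat_exp_def)
  qed
qed

lemma differentiable_upto_flat_exp: "differentiable_upto n (flat_exp p)"
proof (induction n arbitrary: p)
  case 0
  show ?case
    using differentiable_on_UNIV_if_DERIV[OF flat_exp_has_derivative] by (simp add: differentiable_upto_0)
next
  case (Suc n)
  have "deriv (flat_exp p) = flat_exp (monom 1 2 * (p - pderiv p))"
    by (rule deriv_eqI[OF flat_exp_has_derivative])
  with Suc.IH differentiable_on_UNIV_if_DERIV[OF flat_exp_has_derivative] show ?case
    by (simp add: differentiable_upto_Suc)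
qed

text \<open>
  The factor \<open>n\<close> makes the bump steeper: as \<open>n\<close> grows, it increases to the indicator of
  the open interval \<open>(a, b)\<close>.
\<close>

definition bump :: "real \<Rightarrow> real \<Rightarrow> nat \<Rightarrow> real \<Rightarrow> real"
  where "bump a b n x = flat_exp 1 (real n * (x - a)) * flat_exp 1 (real n * (b - x))"

lemma differentiable_upto_bump: "differentiable_upto k (bump a b n)"
proof -
  have "differentiable_upto k (\<lambda>x. flat_exp 1 (real n * x + (- real n * a))
      * flat_exp 1 ((- real n) * x + real n * b))"
    by (intro differentiable_upto_mult differentiable_upto_affine differentiable_upto_flat_exp)
  moreover have "(\<lambda>x. flat_exp 1 (real n * x + (- real n * a))
      * flat_exp 1 ((- real n) * x + real n * b)) = bump a b n"
    by (auto simp: bump_def algebra_simps)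
  ultimately show ?thesis by simp
qed

lemma continuous_on_bump: "continuous_on S (bump a b n)"
  using differentiable_upto_bump[of 0 a b n]
  by (auto simp: differentiable_upto_0 intro: differentiable_imp_continuous_on continuous_on_subset)

lemma bump_eq_0: "x \<le> a \<or> b \<le> x \<Longrightarrow> bump a b n x = 0"
  by (auto simp: bump_def flat_exp_def zero_less_mult_iff)

lemma bump_pos: "a < x \<Longrightarrow> x < b \<Longrightarrow> 0 < n \<Longrightarrow> 0 < bump a b n x"
  by (simp add: bump_def flat_exp_def)

lemma bump_bounds: "0 \<le> bump a b n x" "bump a b n x \<le> 1"
  by (auto simp: bump_def flat_exp_def intro!: mult_le_one)

lemma bump_tendsto: "(\<lambda>n. bump a b n x) \<longlonglongrightarrow> indicat_real {a<..<b} x"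
proof (cases "a < x \<and> x < b")
  case True
  have *: "(\<lambda>n. flat_exp 1 (real n * c)) \<longlonglongrightarrow> 1" if "c > 0" for c
  proof -
    have "(\<lambda>n. exp (- (1 / c * inverse (real n)))) \<longlonglongrightarrow> exp (- (1 / c * 0))"
      by (intro tendsto_intros lim_inverse_n)
    then have "(\<lambda>n. exp (- (1 / c * inverse (real n)))) \<longlonglongrightarrow> 1" by simp
    then show ?thesis
      by (rule Lim_transform_eventually)
         (use that in \<open>auto simp: flat_exp_def field_simps intro!: eventually_mono[OF eventually_gt_at_top[of 0]]\<close>)
  qed
  have "(\<lambda>n. bump a b n x) \<longlonglongrightarrow> 1 * 1"
    unfolding bump_def using True by (intro tendsto_mult *) auto
  then show ?thesis using True by simp
next
  case False
  then show ?thesis by (auto simp: bump_eq_0)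
qed

lemma test_functions_iff:
  "\<phi> \<in> test_functions \<longleftrightarrow> (\<forall>n. differentiable_upto n \<phi>) \<and> closure {x. \<phi> x \<noteq> 0} \<subseteq> {0<..<1}"
  by (auto simp: test_functions_def differentiable_upto_def)

text \<open>
  Derivatives of test functions are exactly the smooth compactly supported functions of integral
  zero. Subtracting the right multiple of a fixed bump gives the bump on \<open>(a, b)\<close> this
  property; its primitive then vanishes to the right of both supports as well as to the left.
\<close>

lemma bump_combination_antiderivative:
  fixes n :: nat
  assumes "0 < a" "a < b" "b < 1" "0 < c" "c < d" "d < 1"
  defines "r \<equiv> integral {0..1} (bump a b n) / integral {0..1} (bump c d 1)"
  shows "\<exists>\<phi>\<in>test_functions. deriv \<phi> = (\<lambda>x. bump a b n x - r * bump c d 1 x)"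
proof -
  define \<eta> where "\<eta> = (\<lambda>x. bump a b n x - r * bump c d 1 x)"
  define \<phi> where "\<phi> = (\<lambda>x. integral {0..x} \<eta>)"
  have cont: "continuous_on S \<eta>" for S
    unfolding \<eta>_def by (intro continuous_intros continuous_on_bump)
  have int: "\<eta> integrable_on {s..t}" for s t
    by (rule integrable_continuous_real[OF cont])
  have z: "\<eta> x = 0" if "x \<le> min a c \<or> max b d \<le> x" for x
    using that by (auto simp: \<eta>_def bump_eq_0)
  have z': "integral {s..t} \<eta> = 0" if "t \<le> min a c \<or> max b d \<le> s" for s t
  proof -
    have "integral {s..t} \<eta> = integral {s..t} (\<lambda>_. 0)"
      by (rule integral_cong) (use that z in auto)
    then show ?thesis by simp
  qed
  have I: "integral {0..1} (bump c d 1) > 0"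
  proof -
    have "bump c d 1 ((c+d)/2) \<noteq> 0" "(c+d)/2 \<in> {0..1}"
      using bump_pos[of c "(c+d)/2" d 1] assms by auto
    then have "integral {0..1} (bump c d 1) \<noteq> 0"
      using integral_eq_0_iff[of 0 1 "bump c d 1"] continuous_on_bump bump_bounds by force
    moreover have "integral {0..1} (bump c d 1) \<ge> 0"
      by (intro integral_nonneg integrable_continuous_real continuous_on_bump bump_bounds)
    ultimately show ?thesis by simp
  qed
  have "integral {0..1} \<eta> = integral {0..1} (bump a b n) - r * integral {0..1} (bump c d 1)"
    unfolding \<eta>_def
    by (subst integral_diff) (auto intro!: integrable_continuous_real continuous_intros continuous_on_bump)
  also have "\<dots> = 0" using I by (simp add: r_def)
  finally have tot: "integral {0..1} \<eta> = 0" .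
  have D: "(\<phi> has_real_derivative \<eta> x) (at x)" for x
  proof -
    define L where "L = min x 0 - 1"
    have eq: "integral {L..y} \<eta> = \<phi> y" if "L < y" for y
    proof (cases "0 \<le> y")
      case True
      then have "integral {L..0} \<eta> + integral {0..y} \<eta> = integral {L..y} \<eta>"
        by (intro Henstock_Kurzweil_Integration.integral_combine int) (auto simp: L_def)
      then show ?thesis using z'[of 0 L] assms by (simp add: \<phi>_def)
    next
      case False
      then show ?thesis using z'[of y L] assms by (simp add: \<phi>_def)
    qed
    have "((\<lambda>y. integral {L..y} \<eta>) has_real_derivative \<eta> x) (at x within {L..x+1})"
      by (rule integral_has_real_derivative[OF cont]) (auto simp: L_def)
    then have "((\<lambda>y. integral {L..y} \<eta>) has_real_derivative \<eta> x) (at x)"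
      by (subst (asm) at_within_interior) (auto simp: L_def)
    then show ?thesis
      by (rule has_field_derivative_transform_within_open[where S="{L<..}"])
         (use eq in \<open>auto simp: L_def\<close>)
  qed
  have \<phi>0: "\<phi> x = 0" if "x \<notin> {min a c..max b d}" for x
  proof (cases "x < min a c")
    case True
    then show ?thesis using z'[of x 0] by (simp add: \<phi>_def)
  next
    case False
    then have "max b d < x" using that by auto
    define m where "m = max b d"
    have m: "0 \<le> m" "m \<le> 1" "m \<le> x" using assms \<open>max b d < x\<close> by (auto simp: m_def)
    have "integral {0..m} \<eta> + integral {m..x} \<eta> = integral {0..x} \<eta>"
         "integral {0..m} \<eta> + integral {m..1} \<eta> = integral {0..1} \<eta>"
      using m by (auto intro!: Henstock_Kurzweil_Integration.integral_combine int)
    then show ?thesis using z'[of x m] z'[of 1 m] tot by (simp add: \<phi>_def m_def)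
  qed
  have "closure {x. \<phi> x \<noteq> 0} \<subseteq> {min a c..max b d}"
    by (rule closure_minimal) (use \<phi>0 in blast, simp)
  also have "\<dots> \<subseteq> {0<..<1}" using assms by auto
  finally have supp: "closure {x. \<phi> x \<noteq> 0} \<subseteq> {0<..<1}" .
  have d\<phi>: "deriv \<phi> = \<eta>" using D by (rule deriv_eqI)
  have "differentiable_upto k \<eta>" for k
  proof -
    have "differentiable_upto k (\<lambda>x. bump a b n x + (- r) * bump c d 1 x)"
      by (intro differentiable_upto_add differentiable_upto_cmult differentiable_upto_bump)
    then show ?thesis by (simp add: \<eta>_def)
  qed
  then have "differentiable_upto (Suc k) \<phi>" for k
    using differentiable_on_UNIV_if_DERIV[OF D] d\<phi> by (simp add: differentiable_upto_Suc)
  then have "differentiable_upto k \<phi>" for k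
    using differentiable_upto_mono by (meson le_SucI order_refl)
  with supp d\<phi> show ?thesis by (auto simp: test_functions_iff \<eta>_def)
qed

section \<open>Integrals over the unit interval\<close>

lemma integrable_unit_leb_iff:
  fixes f :: "real \<Rightarrow> real"
  shows "integrable unit_leb f \<longleftrightarrow> f absolutely_integrable_on {0<..<1}"
  by (simp add: set_integrable_def integrable_restrict_space)

lemma LINT_unit_leb_eq_integral:
  fixes f :: "real \<Rightarrow> real"
  assumes "integrable unit_leb f"
  shows "(LINT x|unit_leb. f x) = integral {0<..<1} f"
  using assms by (rule lebesgue_integral_eq_integral) simp

lemma integrable_on_closed_unit:
  fixes f :: "real \<Rightarrow> real"
  assumes "integrable unit_leb f" "0 \<le> s" "t \<le> 1"
  shows "f integrable_on {s..t}"
proof -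
  have "f absolutely_integrable_on {0..1}"
    using assms absolutely_integrable_on_open_interval[where f=f and a=0 and b=1] by (simp add: integrable_unit_leb_iff)
  then have "f integrable_on {0..1}" by (simp add: absolutely_integrable_on_def)
  then show ?thesis by (rule integrable_on_subinterval) (use assms in auto)
qed

lemma AE_unit_leb_iff:
  "(AE x in unit_leb. P x) \<longleftrightarrow> (AE x in lborel. x \<in> {0<..<1} \<longrightarrow> P x)"
  by (subst AE_restrict_space_iff) (auto simp: AE_completion_iff)

lemma integrable_unit_leb_continuous:
  fixes f :: "real \<Rightarrow> real"
  assumes "continuous_on {0..1} f"
  shows "integrable unit_leb f"
  using absolutely_integrable_continuous_real[OF assms]
    absolutely_integrable_on_open_interval[where f=f and a=0 and b=1]
  by (simp add: integrable_unit_leb_iff)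

lemma integrable_unit_leb_mult_continuous:
  fixes f g :: "real \<Rightarrow> real"
  assumes f: "integrable unit_leb f" and g: "continuous_on {0..1} g"
  shows "integrable unit_leb (\<lambda>x. f x * g x)"
proof -
  have "(\<lambda>x. g x * f x) absolutely_integrable_on {0<..<1}"
  proof (rule absolutely_integrable_bounded_measurable_product_real)
    show "g \<in> borel_measurable unit_leb"
      by (rule continuous_imp_measurable_on_sets_lebesgue[OF continuous_on_subset[OF g]]) auto
    have "bounded (g ` {0..1})"
      by (intro compact_imp_bounded compact_continuous_image g) simp
    then show "bounded (g ` {0<..<1})" by (rule bounded_subset) auto
  qed (use f in \<open>auto simp: integrable_unit_leb_iff\<close>)
  then show ?thesis by (simp add: integrable_unit_leb_iff mult.commute)
qed

text \<open>
  By Lebesgue differentiation, almost every value of an integrable function is a limit of averages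
  over short intervals.
\<close>

lemma AE_zero_if_interval_integrals_zero:
  fixes w :: "real \<Rightarrow> real"
  assumes w: "integrable unit_leb w"
    and zero: "\<And>a b. 0 < a \<Longrightarrow> a < b \<Longrightarrow> b < 1 \<Longrightarrow> integral {a..b} w = 0"
  shows "AE x in unit_leb. w x = 0"
proof -
  define f where "f = (\<lambda>x. if x \<in> {0<..<1} then w x else 0)"
  have fint: "f integrable_on UNIV"
    using w integrable_restrict_UNIV[of "{0<..<1}" w]
    unfolding f_def integrable_unit_leb_iff absolutely_integrable_on_def by blast
  then have "f integrable_on cbox a b" for a b
    using integrable_on_subcbox by blast
  from integrable_ccontinuous_explicit[OF this] obtain N where N: "negligible N"
    "\<And>x e. \<lbrakk>x \<notin> N; 0 < e\<rbrakk> \<Longrightarrow> \<exists>d>0. \<forall>h. 0 < h \<and> h < d \<longrightarrow>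
       norm (integral (cbox x (x + h *\<^sub>R One)) f /\<^sub>R h ^ DIM(real) - f x) < e"
    by metis
  have wz: "w x = 0" if x: "x \<in> {0<..<1}" "x \<notin> N" for x
  proof (rule ccontr)
    assume "w x \<noteq> 0"
    then obtain d where d: "d > 0" "\<And>h. 0 < h \<Longrightarrow> h < d \<Longrightarrow>
        norm (integral {x..x + h} f / h - f x) < \<bar>w x\<bar>"
      using N(2)[OF x(2), of "\<bar>w x\<bar>"] by (auto simp: divide_inverse_commute)
    define h where "h = min (d/2) ((1-x)/2)"
    have h: "0 < h" "h < d" "x + h < 1" using d(1) x by (auto simp: h_def min_def field_simps)
    have "integral {x..x+h} f = integral {x..x+h} w"
      by (rule integral_cong) (use h x in \<open>auto simp: f_def\<close>)
    also have "\<dots> = 0" using h x by (intro zero) auto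
    finally show False using d(2)[OF h(1,2)] x by (simp add: f_def)
  qed
  have "AE x in lebesgue. x \<notin> N"
    using N(1) by (simp add: negligible_iff_null_sets AE_not_in)
  then have "AE x in lebesgue. x \<in> {0<..<1} \<longrightarrow> w x = 0"
    by eventually_elim (use wz in auto)
  then show ?thesis by (subst AE_restrict_space_iff) auto
qed

section \<open>Functions with a weak derivative are primitives\<close>

lemma test_function_deriv:
  assumes "\<phi> \<in> test_functions"
  shows "(\<phi> has_real_derivative deriv \<phi> x) (at x)" "continuous_on S (deriv \<phi>)" "continuous_on S \<phi>"
    "\<phi> 1 = 0" "\<phi> 0 = 0"
proof -
  have "differentiable_upto (Suc 0) \<phi>" using assms by (simp add: test_functions_iff)
  then have d: "\<phi> differentiable_on UNIV" "deriv \<phi> differentiable_on UNIV"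
    by (simp_all add: differentiable_upto_Suc differentiable_upto_0)
  show "(\<phi> has_real_derivative deriv \<phi> x) (at x)"
    by (rule DERIV_deriv_differentiable_on_UNIV[OF d(1)])
  show "continuous_on S (deriv \<phi>)" "continuous_on S \<phi>"
    using d by (auto intro: continuous_on_subset differentiable_imp_continuous_on)
  have "t \<notin> {x. \<phi> x \<noteq> 0}" if "t \<notin> {0<..<1}" for t
    using that assms closure_subset[of "{x. \<phi> x \<noteq> 0}"] by (auto simp: test_functions_iff)
  then show "\<phi> 1 = 0" "\<phi> 0 = 0" by auto
qed

text \<open>
  Let \<open>c\<close> be the mean of \<open>w\<close> against a fixed normalised bump. Orthogonality to all
  derivatives says that \<open>w - c\<close> integrates to zero against every bump, and hence over every
  interval, because bumps converge boundedly to indicators of intervals.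
\<close>

lemma du_Bois_Reymond:
  fixes w :: "real \<Rightarrow> real"
  assumes w: "integrable unit_leb w"
    and orth: "\<And>\<phi>. \<phi> \<in> test_functions \<Longrightarrow> (LINT x|unit_leb. w x * deriv \<phi> x) = 0"
  shows "\<exists>c. AE x in unit_leb. w x = c"
proof -
  define \<psi> where "\<psi> = bump (1/3) (2/3) 1"
  define J where "J = integral {0..1} \<psi>"
  define c where "c = (LINT x|unit_leb. w x * \<psi> x) / J"
  have wb: "integrable unit_leb (\<lambda>x. w x * bump a b n x)" for a b n
    by (rule integrable_unit_leb_mult_continuous[OF w continuous_on_bump])
  have eq: "(LINT x|unit_leb. w x * bump a b n x) = c * integral {0..1} (bump a b n)"
    if ab: "0 < a" "a < b" "b < 1" for a b n
  proof -
    obtain \<phi> where \<phi>: "\<phi> \<in> test_functions"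
      "deriv \<phi> = (\<lambda>x. bump a b n x - integral {0..1} (bump a b n) / J * \<psi> x)"
      using bump_combination_antiderivative[OF ab, of "1/3" "2/3" n] by (auto simp: J_def \<psi>_def)
    have "0 = (LINT x|unit_leb. w x * bump a b n x - integral {0..1} (bump a b n) / J * (w x * \<psi> x))"
      using orth[OF \<phi>(1)] by (simp add: \<phi>(2) algebra_simps)
    also have "\<dots> = (LINT x|unit_leb. w x * bump a b n x)
        - integral {0..1} (bump a b n) / J * (LINT x|unit_leb. w x * \<psi> x)"
      using wb unfolding \<psi>_def by (subst Bochner_Integration.integral_diff) auto
    finally show ?thesis by (simp add: c_def)
  qed
  have one: "integrable unit_leb (\<lambda>x. 1::real)"
    by (rule integrable_unit_leb_continuous) simp
  have wc: "integrable unit_leb (\<lambda>x. w x - c)"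
    using Bochner_Integration.integrable_diff[OF w integrable_mult_right[OF one, of c]] by simp
  have "integral {a..b} (\<lambda>x. w x - c) = 0" if ab: "0 < a" "a < b" "b < 1" for a b
  proof -
    have b0: "(LINT x|unit_leb. bump a b n x) = integral {0..1} (bump a b n)" for n
    proof -
      have "integrable unit_leb (bump a b n)"
        using integrable_unit_leb_mult_continuous[OF one continuous_on_bump] by simp
      then show ?thesis
        by (simp add: LINT_unit_leb_eq_integral integral_open_interval_real)
    qed
    have abs: "{a<..<b} \<in> sets unit_leb"
      using ab by (auto simp: sets_restrict_space intro!: image_eqI[where x="{a<..<b}"])
    have lim: "(\<lambda>n. LINT x|unit_leb. (w x - c) * bump a b n x)
        \<longlonglongrightarrow> (LINT x|unit_leb. (w x - c) * indicat_real {a<..<b} x)"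
    proof (rule integral_dominated_convergence[where w="\<lambda>x. \<bar>w x - c\<bar>"])
      show "AE x in unit_leb. (\<lambda>n. (w x - c) * bump a b n x) \<longlonglongrightarrow> (w x - c) * indicat_real {a<..<b} x"
        by (intro AE_I2 tendsto_intros bump_tendsto)
      show "AE x in unit_leb. norm ((w x - c) * bump a b n x) \<le> \<bar>w x - c\<bar>" for n
        by (intro AE_I2) (auto simp: abs_mult intro!: mult_left_le bump_bounds
            simp: abs_of_nonneg[OF bump_bounds(1)])
      show "(\<lambda>x. (w x - c) * bump a b n x) \<in> borel_measurable unit_leb" for n
        using integrable_unit_leb_mult_continuous[OF wc continuous_on_bump] by auto
      show "(\<lambda>x. (w x - c) * indicat_real {a<..<b} x) \<in> borel_measurable unit_leb"
        by (intro borel_measurable_times borel_measurable_integrable[OF wc] borel_measurable_indicator abs)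
    qed (use wc in auto)
    have "(LINT x|unit_leb. (w x - c) * bump a b n x) = 0" for n
    proof -
      have "(LINT x|unit_leb. (w x - c) * bump a b n x)
         = (LINT x|unit_leb. w x * bump a b n x) - c * (LINT x|unit_leb. bump a b n x)"
        using wb[of a b n] integrable_unit_leb_mult_continuous[OF one continuous_on_bump, of a b n]
        by (simp add: left_diff_distrib)
      then show ?thesis using eq[OF ab, of n] b0 by simp
    qed
    with lim have "(LINT x|unit_leb. (w x - c) * indicat_real {a<..<b} x) = 0"
      by (simp add: LIMSEQ_const_iff)
    moreover have "integrable unit_leb (\<lambda>x. (w x - c) * indicat_real {a<..<b} x)"
      by (rule integrable_real_mult_indicator[OF abs wc])
    ultimately have "integral {0<..<1} (\<lambda>x. (w x - c) * indicat_real {a<..<b} x) = 0"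
      by (simp add: LINT_unit_leb_eq_integral)
    moreover have "integral {0<..<1} (\<lambda>x. (w x - c) * indicat_real {a<..<b} x)
        = integral {0<..<1} (\<lambda>x. if x \<in> {a<..<b} then w x - c else 0)"
      by (rule integral_cong) auto
    moreover have "\<dots> = integral ({a<..<b} \<inter> {0<..<1}) (\<lambda>x. w x - c)"
      by (simp only: integral_restrict_Int Int_commute)
    moreover have "{a<..<b} \<inter> {0<..<1} = {a<..<b}" using ab by auto
    ultimately show ?thesis by (simp add: integral_open_interval_real)
  qed
  then have "AE x in unit_leb. w x - c = 0"
    by (rule AE_zero_if_interval_integrals_zero[OF wc])
  then show ?thesis by auto
qed

text \<open>
  Integration by parts for a primitive of a merely integrable function. Fubini's theorem on the
  triangle \<open>t \<le> x\<close> moves the integral from \<open>g\<close> to \<open>\<phi>'\<close>. It is applied to a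
  Borel version \<open>g'\<close> of \<open>g\<close>, extended by zero to the line.
\<close>

lemma weak_deriv_primitive:
  assumes g: "integrable unit_leb g"
    and um: "u \<in> borel_measurable unit_leb"
    and u: "AE x in unit_leb. u x = c + integral {0..x} g"
  shows "weak_deriv u g"
  unfolding weak_deriv_def
proof
  fix \<phi> assume \<phi>: "\<phi> \<in> test_functions"
  note \<phi>' = test_function_deriv[OF \<phi>]
  define W where "W x = integral {0..x} g" for x
  define \<psi> where "\<psi> x = indicator {0<..<1} x * deriv \<phi> x" for x :: real
  define g0 where "g0 x = indicator {0<..<1} x * g x" for x
  have W_cont: "continuous_on {0..1} W"
    unfolding W_def by (rule indefinite_integral_continuous_1) (use integrable_on_closed_unit[OF g] in auto)
  have g0: "integrable lebesgue g0"
    using g by (simp add: integrable_restrict_space g0_def[abs_def])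
  then obtain g' where g'm [measurable]: "g' \<in> borel_measurable lborel" and "AE x in lborel. g0 x = g' x"
    using completion_ex_borel_measurable_real[of g0 lborel] by auto
  then have ae: "AE x in lebesgue. g0 x = g' x" by (simp add: AE_completion)
  have "integrable lebesgue g'"
    using integrable_cong_AE_imp[OF g0 _ ae] g'm by (simp add: measurable_completion)
  then have g'i: "integrable lborel g'" by (simp add: integrable_completion)
  have \<psi>m [measurable]: "\<psi> \<in> borel_measurable borel"
    unfolding \<psi>_def by (intro borel_measurable_times borel_measurable_continuous_onI[where f="deriv \<phi>"] \<phi>') auto
  have "integrable unit_leb (deriv \<phi>)" by (rule integrable_unit_leb_continuous[OF \<phi>'(2)])
  then have "integrable lebesgue \<psi>" by (simp add: integrable_restrict_space \<psi>_def[abs_def])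
  then have \<psi>i: "integrable lborel \<psi>" by (simp add: integrable_completion)
  have prod: "integrable (lborel \<Otimes>\<^sub>M lborel) (\<lambda>(x, t). \<psi> x * g' t)"
  proof (rule lborel_pair.Fubini_integrable)
    show "integrable lborel (\<lambda>x. \<integral>y. norm (case (x, y) of (x, t) \<Rightarrow> \<psi> x * g' t) \<partial>lborel)"
      using \<psi>i g'i by (simp add: abs_mult)
    show "AE x in lborel. integrable lborel (\<lambda>y. case (x, y) of (x, t) \<Rightarrow> \<psi> x * g' t)"
      using g'i by simp
  qed simp
  have F: "integrable (lborel \<Otimes>\<^sub>M lborel) (\<lambda>(x, t). if t \<le> x then \<psi> x * g' t else 0)"
    by (rule Bochner_Integration.integrable_bound[OF prod]) auto
  \<comment> \<open>The two inner integrals over the triangle \<open>t \<le> x\<close>.\<close>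
  define K where "K x = (\<integral>t. indicator {..x} t * g' t \<partial>lborel)" for x :: real
  define L where "L t = (\<integral>x. indicator {t..} x * \<psi> x \<partial>lborel)" for t :: real
  have Km [measurable]: "K \<in> borel_measurable borel"
  proof -
    have "(\<lambda>x. \<integral>t. (if t \<le> x then g' t else 0) \<partial>lborel) \<in> borel_measurable borel"
      by measurable
    moreover have "(\<lambda>x. \<integral>t. (if t \<le> x then g' t else 0) \<partial>lborel) = K"
      unfolding K_def by (intro ext Bochner_Integration.integral_cong) auto
    ultimately show ?thesis by simp
  qed
  have Lm [measurable]: "L \<in> borel_measurable borel"
  proof -
    have "(\<lambda>t. \<integral>x. (if t \<le> x then \<psi> x else 0) \<partial>lborel) \<in> borel_measurable borel"
      by measurable
    moreover have "(\<lambda>t. \<integral>x. (if t \<le> x then \<psi> x else 0) \<partial>lborel) = L"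
      unfolding L_def by (intro ext Bochner_Integration.integral_cong) auto
    ultimately show ?thesis by simp
  qed
  have fub: "(\<integral>x. \<psi> x * K x \<partial>lborel) = (\<integral>t. g' t * L t \<partial>lborel)"
  proof -
    have "(\<integral>x. \<psi> x * K x \<partial>lborel) = (\<integral>x. (\<integral>t. (if t \<le> x then \<psi> x * g' t else 0) \<partial>lborel) \<partial>lborel)"
      unfolding K_def integral_mult_right_zero[symmetric]
      by (intro Bochner_Integration.integral_cong) (auto simp: indicator_def)
    also have "\<dots> = (\<integral>t. (\<integral>x. (if t \<le> x then \<psi> x * g' t else 0) \<partial>lborel) \<partial>lborel)"
      by (rule lborel_pair.Fubini_integral[OF F, symmetric])
    also have "\<dots> = (\<integral>t. g' t * L t \<partial>lborel)"
      unfolding L_def integral_mult_right_zero[symmetric]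
      by (intro Bochner_Integration.integral_cong) (auto simp: indicator_def)
    finally show ?thesis .
  qed
  have K: "K x = W x" if x: "x \<in> {0<..<1}" for x
  proof -
    have "K x = (\<integral>t. indicator {..x} t * g' t \<partial>lebesgue)"
      unfolding K_def by (rule integral_completion[symmetric]) measurable
    also have "\<dots> = (\<integral>t. indicator {0<..x} t *\<^sub>R g t \<partial>lebesgue)"
    proof (rule integral_cong_AE)
      show "AE t in lebesgue. indicator {..x} t * g' t = indicator {0<..x} t *\<^sub>R g t"
        using ae by eventually_elim (use x in \<open>auto simp: g0_def indicator_def split: if_splits\<close>)
      have "(\<lambda>t. indicator {0<..x} t * g0 t) \<in> borel_measurable lebesgue"
        by (intro borel_measurable_times borel_measurable_integrable[OF g0] borel_measurable_indicator) simp
      moreover have "(\<lambda>t. indicator {0<..x} t * g0 t) = (\<lambda>t. indicator {0<..x} t *\<^sub>R g t)"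
        using x by (auto simp: g0_def indicator_def)
      ultimately show "(\<lambda>t. indicator {0<..x} t *\<^sub>R g t) \<in> borel_measurable lebesgue" by simp
    qed (auto intro: measurable_completion)
    also have "\<dots> = integral {0<..x} g"
    proof -
      have "g absolutely_integrable_on {0<..x}"
        by (rule set_integrable_subset[where A="{0<..<1}"])
           (use g x in \<open>auto simp: integrable_unit_leb_iff\<close>)
      then show ?thesis
        using set_lebesgue_integral_eq_integral(2) unfolding set_lebesgue_integral_def by blast
    qed
    also have "\<dots> = W x"
      unfolding W_def by (rule integral_spike_set) (auto intro: negligible_subset[of "{0}"])
    finally show ?thesis .
  qed
  have L: "L t = - \<phi> t" if t: "t \<in> {0<..<1}" for t
  proof -
    have "L t = (\<integral>x. indicator {t..} x * \<psi> x \<partial>lebesgue)"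
      unfolding L_def by (rule integral_completion[symmetric]) measurable
    also have "\<dots> = (\<integral>x. indicator {t..<1} x *\<^sub>R deriv \<phi> x \<partial>lebesgue)"
      by (rule Bochner_Integration.integral_cong) (use t in \<open>auto simp: \<psi>_def indicator_def\<close>)
    also have "\<dots> = integral {t..<1} (deriv \<phi>)"
    proof -
      have "deriv \<phi> absolutely_integrable_on {t..<1}"
        by (rule set_integrable_subset[where A="{t..1}"])
           (auto intro: absolutely_integrable_continuous_real \<phi>')
      then show ?thesis
        using set_lebesgue_integral_eq_integral(2) unfolding set_lebesgue_integral_def by blast
    qed
    also have "\<dots> = integral {t..1} (deriv \<phi>)"
      by (rule integral_spike_set) (auto intro: negligible_subset[of "{1}"])
    also have "\<dots> = \<phi> 1 - \<phi> t"
      by (intro integral_unique fundamental_theorem_of_calculus)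
         (use t \<phi>'(1) in \<open>auto simp flip: has_real_derivative_iff_has_vector_derivative
            intro: has_field_derivative_at_within\<close>)
    finally show ?thesis using \<phi>'(4) by simp
  qed
  have left: "(LINT x|unit_leb. W x * deriv \<phi> x) = (\<integral>x. \<psi> x * K x \<partial>lborel)"
  proof -
    have "(LINT x|unit_leb. W x * deriv \<phi> x) = (\<integral>x. indicator {0<..<1} x *\<^sub>R (W x * deriv \<phi> x) \<partial>lebesgue)"
      by (rule integral_restrict_space) simp
    also have "\<dots> = (\<integral>x. \<psi> x * K x \<partial>lebesgue)"
      by (rule Bochner_Integration.integral_cong) (auto simp: \<psi>_def K indicator_def)
    also have "\<dots> = (\<integral>x. \<psi> x * K x \<partial>lborel)"
      by (rule integral_completion) measurable
    finally show ?thesis .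
  qed
  have right: "(\<integral>t. g' t * L t \<partial>lborel) = - (LINT x|unit_leb. g x * \<phi> x)"
  proof -
    have "(LINT x|unit_leb. - (g x * \<phi> x)) = (\<integral>x. indicator {0<..<1} x *\<^sub>R - (g x * \<phi> x) \<partial>lebesgue)"
      by (rule integral_restrict_space) simp
    also have "\<dots> = (\<integral>t. g' t * L t \<partial>lebesgue)"
    proof (rule integral_cong_AE)
      show "AE t in lebesgue. indicator {0<..<1} t *\<^sub>R - (g t * \<phi> t) = g' t * L t"
        using ae by eventually_elim (auto simp: g0_def indicator_def L split: if_splits)
      have "(\<lambda>t. - (g0 t * \<phi> t)) \<in> borel_measurable lebesgue"
        by (intro borel_measurable_uminus borel_measurable_times borel_measurable_integrable[OF g0]
          measurable_completion) (auto intro: borel_measurable_continuous_onI \<phi>')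
      then show "(\<lambda>t. indicator {0<..<1} t *\<^sub>R - (g t * \<phi> t)) \<in> borel_measurable lebesgue"
        by (simp add: g0_def mult.assoc)
      show "(\<lambda>t. g' t * L t) \<in> borel_measurable lebesgue" by (rule measurable_completion) measurable
    qed
    also have "\<dots> = (\<integral>t. g' t * L t \<partial>lborel)"
      by (rule integral_completion) measurable
    finally show ?thesis by simp
  qed
  have "(LINT x|unit_leb. u x * deriv \<phi> x) = (LINT x|unit_leb. c * deriv \<phi> x + W x * deriv \<phi> x)"
  proof (rule integral_cong_AE)
    have m: "deriv \<phi> \<in> borel_measurable unit_leb" "W \<in> borel_measurable unit_leb"
      using integrable_unit_leb_continuous[OF \<phi>'(2)] integrable_unit_leb_continuous[OF W_cont] by auto
    then show "(\<lambda>x. u x * deriv \<phi> x) \<in> borel_measurable unit_leb"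
      "(\<lambda>x. c * deriv \<phi> x + W x * deriv \<phi> x) \<in> borel_measurable unit_leb"
      using um by measurable
    show "AE x in unit_leb. u x * deriv \<phi> x = c * deriv \<phi> x + W x * deriv \<phi> x"
      using u by eventually_elim (auto simp: W_def algebra_simps)
  qed
  also have "\<dots> = c * (LINT x|unit_leb. deriv \<phi> x) + (LINT x|unit_leb. W x * deriv \<phi> x)"
    using integrable_unit_leb_continuous[OF \<phi>'(2)]
      integrable_unit_leb_continuous[OF continuous_on_mult[OF W_cont \<phi>'(2)]] by simp
  also have "(LINT x|unit_leb. deriv \<phi> x) = integral {0..1} (deriv \<phi>)"
    using integrable_unit_leb_continuous[OF \<phi>'(2)]
    by (simp add: LINT_unit_leb_eq_integral integral_open_interval_real)
  also have "\<dots> = \<phi> 1 - \<phi> 0"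
    by (intro integral_unique fundamental_theorem_of_calculus)
       (use \<phi>'(1) in \<open>auto simp flip: has_real_derivative_iff_has_vector_derivative
          intro: has_field_derivative_at_within\<close>)
  also have "\<dots> = 0" using \<phi>'(4,5) by simp
  finally show "(LINT x|unit_leb. u x * deriv \<phi> x) = - (LINT x|unit_leb. g x * \<phi> x)"
    using left right fub by simp
qed

lemma integrable_L2_unit:
  assumes "f \<in> L2_unit"
  shows "integrable unit_leb f"
proof -
  have "integrable unit_leb (\<lambda>x. (f x)\<^sup>2 + 1)"
    using assms integrable_unit_leb_continuous[OF continuous_on_const]
    by (intro Bochner_Integration.integrable_add) (auto simp: L2_unit_def)
  then show ?thesis
  proof (rule Bochner_Integration.integrable_bound)
    have "\<bar>y\<bar> \<le> y\<^sup>2 + 1" for y :: real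
    proof (cases "\<bar>y\<bar> \<le> 1")
      case False
      then have "\<bar>y\<bar> * 1 \<le> \<bar>y\<bar> * \<bar>y\<bar>" by (intro mult_left_mono) auto
      then show ?thesis by (simp add: power2_eq_square)
    qed (smt (verit) zero_le_power2)
    then show "AE x in unit_leb. norm (f x) \<le> norm ((f x)\<^sup>2 + 1)"
      by (intro AE_I2) (simp add: abs_of_nonneg)
  qed (use assms in \<open>auto simp: L2_unit_def\<close>)
qed

text \<open>
  The primitive \<open>W\<close> of \<open>u'\<close> has the weak derivative \<open>u'\<close> too, so \<open>u - W\<close> is
  orthogonal to all derivatives of test functions.
\<close>

lemma H1_unit_imp_primitive:
  assumes "(u, u') \<in> H1_unit"
  shows "\<exists>c. AE x in unit_leb. u x = c + integral {0..x} u'"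
proof -
  have u: "integrable unit_leb u" and u': "integrable unit_leb u'" and wd: "weak_deriv u u'"
    using assms by (auto simp: H1_unit_def intro: integrable_L2_unit)
  define W where "W x = integral {0..x} u'" for x
  have W_cont: "continuous_on {0..1} W"
    unfolding W_def by (rule indefinite_integral_continuous_1) (use integrable_on_closed_unit[OF u'] in auto)
  have Wi: "integrable unit_leb W" by (rule integrable_unit_leb_continuous[OF W_cont])
  have "weak_deriv W u'"
    by (rule weak_deriv_primitive[where c=0, OF u']) (use Wi in \<open>auto simp: W_def\<close>)
  have "\<exists>c. AE x in unit_leb. u x - W x = c"
  proof (rule du_Bois_Reymond)
    show "integrable unit_leb (\<lambda>x. u x - W x)" using u Wi by auto
    fix \<phi> assume \<phi>: "\<phi> \<in> test_functions"
    have "integrable unit_leb (\<lambda>x. u x * deriv \<phi> x)" "integrable unit_leb (\<lambda>x. W x * deriv \<phi> x)"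
      using u Wi test_function_deriv[OF \<phi>] by (auto intro: integrable_unit_leb_mult_continuous)
    then have "(LINT x|unit_leb. (u x - W x) * deriv \<phi> x)
        = (LINT x|unit_leb. u x * deriv \<phi> x) - (LINT x|unit_leb. W x * deriv \<phi> x)"
      by (simp add: left_diff_distrib)
    then show "(LINT x|unit_leb. (u x - W x) * deriv \<phi> x) = 0"
      using wd \<open>weak_deriv W u'\<close> \<phi> by (simp add: weak_deriv_def)
  qed
  then obtain c where "AE x in unit_leb. u x - W x = c" by blast
  then have "AE x in unit_leb. u x = c + integral {0..x} u'"
    by eventually_elim (simp add: W_def)
  then show ?thesis by blast
qed

lemma continuous_on_primitive:
  fixes g :: "real \<Rightarrow> real"
  assumes "integrable unit_leb g"
  shows "continuous_on {0..1} (\<lambda>x. c + integral {0..x} g)" 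
  by (intro continuous_intros indefinite_integral_continuous_1 integrable_on_closed_unit[OF assms]) auto

lemma primitive_in_H1_unit:
  assumes g: "g \<in> L2_unit"
  shows "(\<lambda>x. c + integral {0..x} g, g) \<in> H1_unit"
proof -
  have gi: "integrable unit_leb g" by (rule integrable_L2_unit[OF g])
  note cont = continuous_on_primitive[OF gi, of c]
  have "weak_deriv (\<lambda>x. c + integral {0..x} g) g"
    by (rule weak_deriv_primitive[OF gi, where c=c]) (use integrable_unit_leb_continuous[OF cont] in auto)
  moreover have "(\<lambda>x. c + integral {0..x} g) \<in> L2_unit"
    using integrable_unit_leb_continuous[OF cont] integrable_unit_leb_continuous[OF continuous_on_power[OF cont]]
    by (auto simp: L2_unit_def)
  ultimately show ?thesis using g by (simp add: H1_unit_def)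
qed

section \<open>Variational characterisation of the eigenvalues\<close>

text \<open>
  Both eigenvalues have this form, with a density \<open>\<rho>\<close> in the denominator and in the
  orthogonality condition and a stiffness \<open>k\<close> in the numerator.
\<close>

definition rayleigh_inf :: "(real \<Rightarrow> real) \<Rightarrow> (real \<Rightarrow> real) \<Rightarrow> real"
  where "rayleigh_inf \<rho> k = Inf
    {(LINT x|unit_leb. (u' x)\<^sup>2 * k x) / (LINT x|unit_leb. (u x)\<^sup>2 * \<rho> x) | u u'.
       (u, u') \<in> H1_unit \<and> \<not> (AE x in unit_leb. u x = 0) \<and>
       (LINT x|unit_leb. u x * \<rho> x) = 0}"

lemma mu1_eq_rayleigh_inf: "mu1 h = rayleigh_inf h h"
  by (simp add: mu1_def rayleigh_inf_def)

lemma sigma1_eq_rayleigh_inf: "sigma1 k = rayleigh_inf (\<lambda>_. 1) k"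
  by (simp add: sigma1_def rayleigh_inf_def)

lemma measure_unit_leb: "measure unit_leb {0<..<1} = 1"
  by (subst measure_restrict_space) auto

lemma LINT_unit_leb_pos:
  fixes f :: "real \<Rightarrow> real"
  assumes i: "integrable unit_leb f" and pos: "\<And>x. x \<in> {0<..<1} \<Longrightarrow> 0 < f x"
  shows "0 < (LINT x|unit_leb. f x)"
proof -
  have nn: "AE x in unit_leb. 0 \<le> f x"
    using pos by (intro AE_I2) (auto intro: less_imp_le)
  have "(LINT x|unit_leb. f x) \<noteq> 0"
  proof
    assume "(LINT x|unit_leb. f x) = 0"
    then have "AE x in unit_leb. f x = 0"
      using integral_nonneg_eq_0_iff_AE[OF i nn] by simp
    then have "AE x in unit_leb. False"
      using AE_space by eventually_elim (use pos in force)
    then have "(LINT x|unit_leb. 1::real) = (LINT x|unit_leb. 0)"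
      by (intro integral_cong_AE) auto
    then show False by (simp add: measure_unit_leb)
  qed
  with integral_nonneg_AE[OF nn] show ?thesis by simp
qed

lemma LINT_square_weight_eq_0_iff:
  fixes \<rho> u :: "real \<Rightarrow> real"
  assumes \<rho>: "continuous_on {0..1} \<rho>" "\<And>x. x \<in> {0<..<1} \<Longrightarrow> 0 < \<rho> x"
    and u: "continuous_on {0..1} u"
  shows "(LINT x|unit_leb. (u x)\<^sup>2 * \<rho> x) = 0 \<longleftrightarrow> (AE x in unit_leb. u x = 0)"
proof -
  have "integrable unit_leb (\<lambda>x. (u x)\<^sup>2 * \<rho> x)"
    by (intro integrable_unit_leb_continuous continuous_intros assms)
  moreover have "AE x in unit_leb. 0 \<le> (u x)\<^sup>2 * \<rho> x"
    using \<rho>(2) by (intro AE_I2 mult_nonneg_nonneg) (auto intro: less_imp_le)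
  ultimately have "(LINT x|unit_leb. (u x)\<^sup>2 * \<rho> x) = 0 \<longleftrightarrow> (AE x in unit_leb. (u x)\<^sup>2 * \<rho> x = 0)"
    by (rule integral_nonneg_eq_0_iff_AE)
  also have "\<dots> \<longleftrightarrow> (AE x in unit_leb. u x = 0)"
    using \<rho>(2) by (intro AE_cong) force
  finally show ?thesis .
qed

lemma const_in_L2_unit: "(\<lambda>_. c) \<in> L2_unit"
  using integrable_unit_leb_continuous[OF continuous_on_const[where c="c\<^sup>2"]] by (auto simp: L2_unit_def)

text \<open>
  A lower bound for the infimum is a quadratic inequality for the functions of mean zero, and it is
  enough to test it on primitives, since every element of \<open>H\<^sup>1\<close> agrees almost everywhere with
  one. Stated without quotients, the inequality is trivially true for a vanishing function. The real
  infimum is meaningful because the affine function \<open>x + c\<close> of mean zero is admissible and all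
  quotients are nonnegative.
\<close>

lemma le_rayleigh_inf_iff:
  fixes \<rho> k :: "real \<Rightarrow> real"
  assumes \<rho>: "continuous_on {0..1} \<rho>" "\<And>x. x \<in> {0<..<1} \<Longrightarrow> 0 < \<rho> x"
    and k: "\<And>x. x \<in> {0<..<1} \<Longrightarrow> 0 \<le> k x"
  shows "C \<le> rayleigh_inf \<rho> k \<longleftrightarrow>
    (\<forall>c. \<forall>g\<in>L2_unit. (LINT x|unit_leb. (c + integral {0..x} g) * \<rho> x) = 0 \<longrightarrow>
      C * (LINT x|unit_leb. (c + integral {0..x} g)\<^sup>2 * \<rho> x) \<le> (LINT x|unit_leb. (g x)\<^sup>2 * k x))"
    (is "_ \<longleftrightarrow> ?R")
proof -
  define Q where "Q = {(LINT x|unit_leb. (u' x)\<^sup>2 * k x) / (LINT x|unit_leb. (u x)\<^sup>2 * \<rho> x) | u u'.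
       (u, u') \<in> H1_unit \<and> \<not> (AE x in unit_leb. u x = 0) \<and>
       (LINT x|unit_leb. u x * \<rho> x) = 0}"
  have num: "0 \<le> (LINT x|unit_leb. (g x)\<^sup>2 * k x)" for g :: "real \<Rightarrow> real"
    using k by (intro integral_nonneg_AE AE_I2) auto
  have den: "0 \<le> (LINT x|unit_leb. (u x)\<^sup>2 * \<rho> x)" for u :: "real \<Rightarrow> real"
    using \<rho>(2) by (intro integral_nonneg_AE AE_I2 mult_nonneg_nonneg) (auto intro: less_imp_le)
  have bdd: "bdd_below Q"
    by (rule bdd_belowI[where m=0]) (auto simp: Q_def num den)
  have "Q \<noteq> {}"
  proof -
    define m where "m = (LINT x|unit_leb. \<rho> x)"
    define c where "c = - (LINT x|unit_leb. x * \<rho> x) / m"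
    define u :: "real \<Rightarrow> real" where "u = (\<lambda>x. c + integral {0..x} (\<lambda>_. 1))"
    have u: "u x = c + x" if "x \<in> {0<..<1}" for x using that by (simp add: u_def)
    have m: "m > 0" unfolding m_def by (rule LINT_unit_leb_pos[OF integrable_unit_leb_continuous[OF \<rho>(1)] \<rho>(2)])
    have "(LINT x|unit_leb. u x * \<rho> x) = (LINT x|unit_leb. c * \<rho> x + x * \<rho> x)"
      by (rule Bochner_Integration.integral_cong) (auto simp: u algebra_simps)
    also have "\<dots> = c * m + (LINT x|unit_leb. x * \<rho> x)"
      using integrable_unit_leb_continuous[OF \<rho>(1)]
        integrable_unit_leb_continuous[OF continuous_on_mult[OF continuous_on_id \<rho>(1)]]
      by (simp add: m_def)
    also have "\<dots> = 0" using m by (simp add: c_def)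
    finally have 1: "(LINT x|unit_leb. u x * \<rho> x) = 0" .
    have 2: "\<not> (AE x in unit_leb. u x = 0)"
    proof
      assume "AE x in unit_leb. u x = 0"
      moreover have "AE x in lborel. x \<noteq> - c" by (rule AE_lborel_singleton)
      then have "AE x in unit_leb. x \<noteq> - c" unfolding AE_unit_leb_iff by eventually_elim simp
      ultimately have "AE x in unit_leb. False"
        using AE_space by eventually_elim (auto simp: u)
      then have "(LINT x|unit_leb. \<rho> x) = (LINT x|unit_leb. 0)"
        using integrable_unit_leb_continuous[OF \<rho>(1)] by (intro integral_cong_AE) auto
      with m show False by (simp add: m_def)
    qed
    have "(u, \<lambda>_. 1) \<in> H1_unit"
      unfolding u_def by (rule primitive_in_H1_unit[OF const_in_L2_unit])
    with 1 2 show ?thesis unfolding Q_def by blast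
  qed
  then have iff: "C \<le> rayleigh_inf \<rho> k \<longleftrightarrow> (\<forall>q\<in>Q. C \<le> q)"
    using le_cInf_iff[OF _ bdd] by (simp add: rayleigh_inf_def Q_def)
  show ?thesis
    unfolding iff
  proof (intro iffI ballI allI impI)
    fix c g
    assume le: "\<forall>q\<in>Q. C \<le> q" and g: "g \<in> L2_unit"
      and mean: "(LINT x|unit_leb. (c + integral {0..x} g) * \<rho> x) = 0"
    define u where "u = (\<lambda>x. c + integral {0..x} g)"
    have ucont: "continuous_on {0..1} u"
      unfolding u_def by (rule continuous_on_primitive[OF integrable_L2_unit[OF g]])
    have mem: "(u, g) \<in> H1_unit" unfolding u_def by (rule primitive_in_H1_unit[OF g])
    show "C * (LINT x|unit_leb. (c + integral {0..x} g)\<^sup>2 * \<rho> x) \<le> (LINT x|unit_leb. (g x)\<^sup>2 * k x)"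
    proof (cases "AE x in unit_leb. u x = 0")
      case True
      then have "(LINT x|unit_leb. (u x)\<^sup>2 * \<rho> x) = 0"
        using LINT_square_weight_eq_0_iff[OF \<rho> ucont] by simp
      then show ?thesis using num[of g] by (simp add: u_def)
    next
      case False
      then have pos: "0 < (LINT x|unit_leb. (u x)\<^sup>2 * \<rho> x)"
        using LINT_square_weight_eq_0_iff[OF \<rho> ucont] den[of u] by simp
      have "C \<le> (LINT x|unit_leb. (g x)\<^sup>2 * k x) / (LINT x|unit_leb. (u x)\<^sup>2 * \<rho> x)"
        by (rule le[rule_format]) (use mem False mean in \<open>auto simp: Q_def u_def\<close>)
      then show ?thesis using pos by (simp add: u_def pos_le_divide_eq)
    qed
  next
    fix q assume R: ?R and "q \<in> Q"
    then obtain u g where q: "q = (LINT x|unit_leb. (g x)\<^sup>2 * k x) / (LINT x|unit_leb. (u x)\<^sup>2 * \<rho> x)"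
      and mem: "(u, g) \<in> H1_unit" and nz: "\<not> (AE x in unit_leb. u x = 0)"
      and mean: "(LINT x|unit_leb. u x * \<rho> x) = 0"
      by (auto simp: Q_def)
    have g: "g \<in> L2_unit" and um: "u \<in> borel_measurable unit_leb"
      using mem by (auto simp: H1_unit_def L2_unit_def)
    obtain c where c: "AE x in unit_leb. u x = c + integral {0..x} g"
      using H1_unit_imp_primitive[OF mem] by blast
    define v where "v = (\<lambda>x. c + integral {0..x} g)"
    have vcont: "continuous_on {0..1} v"
      unfolding v_def by (rule continuous_on_primitive[OF integrable_L2_unit[OF g]])
    have uv: "AE x in unit_leb. u x = v x" using c by (simp add: v_def)
    have vm: "v \<in> borel_measurable unit_leb" "\<rho> \<in> borel_measurable unit_leb"
      using integrable_unit_leb_continuous[OF vcont] integrable_unit_leb_continuous[OF \<rho>(1)] by auto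
    have "(LINT x|unit_leb. v x * \<rho> x) = (LINT x|unit_leb. u x * \<rho> x)"
      using um vm uv by (intro integral_cong_AE) auto
    with mean have mean': "(LINT x|unit_leb. v x * \<rho> x) = 0" by simp
    have sq: "(LINT x|unit_leb. (v x)\<^sup>2 * \<rho> x) = (LINT x|unit_leb. (u x)\<^sup>2 * \<rho> x)"
      using um vm uv by (intro integral_cong_AE) auto
    have "\<not> (AE x in unit_leb. v x = 0)"
    proof
      assume "AE x in unit_leb. v x = 0"
      with uv have "AE x in unit_leb. u x = 0" by eventually_elim simp
      with nz show False by simp
    qed
    then have pos: "0 < (LINT x|unit_leb. (u x)\<^sup>2 * \<rho> x)"
      using LINT_square_weight_eq_0_iff[OF \<rho> vcont] den[of u] sq by simp
    have "C * (LINT x|unit_leb. (v x)\<^sup>2 * \<rho> x) \<le> (LINT x|unit_leb. (g x)\<^sup>2 * k x)"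
      using R g mean' by (auto simp: v_def)
    then show "C \<le> q" using pos by (simp add: q sq pos_le_divide_eq)
  qed
qed

lemma le_rayleigh_infI:
  fixes \<rho> k :: "real \<Rightarrow> real"
  assumes "continuous_on {0..1} \<rho>" "\<And>x. x \<in> {0<..<1} \<Longrightarrow> 0 < \<rho> x"
    and "\<And>x. x \<in> {0<..<1} \<Longrightarrow> 0 \<le> k x"
    and "\<And>c g. g \<in> L2_unit \<Longrightarrow> (LINT x|unit_leb. (c + integral {0..x} g) * \<rho> x) = 0 \<Longrightarrow>
      C * (LINT x|unit_leb. (c + integral {0..x} g)\<^sup>2 * \<rho> x) \<le> (LINT x|unit_leb. (g x)\<^sup>2 * k x)"
  shows "C \<le> rayleigh_inf \<rho> k"
  using assms by (subst le_rayleigh_inf_iff) auto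

lemma rayleigh_inf_le:
  fixes \<rho> k :: "real \<Rightarrow> real"
  assumes "continuous_on {0..1} \<rho>" "\<And>x. x \<in> {0<..<1} \<Longrightarrow> 0 < \<rho> x"
    and "\<And>x. x \<in> {0<..<1} \<Longrightarrow> 0 \<le> k x"
    and "g \<in> L2_unit" "(LINT x|unit_leb. (c + integral {0..x} g) * \<rho> x) = 0"
  shows "rayleigh_inf \<rho> k * (LINT x|unit_leb. (c + integral {0..x} g)\<^sup>2 * \<rho> x)
    \<le> (LINT x|unit_leb. (g x)\<^sup>2 * k x)"
  by (rule le_rayleigh_inf_iff[where \<rho>=\<rho> and k=k, THEN iffD1, rule_format, OF _ _ _ order_refl])
     (use assms in auto)

section \<open>Changes of variable on the unit interval\<close>

text \<open>
  The derivative is prescribed in the open interval only: for the changes of variable below it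
  vanishes, or tends to infinity, at an endpoint where the weight vanishes.
\<close>

definition unit_reparam :: "(real \<Rightarrow> real) \<Rightarrow> (real \<Rightarrow> real) \<Rightarrow> bool"
  where "unit_reparam H w \<longleftrightarrow> continuous_on {0..1} H \<and> H 0 = 0 \<and> H 1 = 1 \<and>
    (\<forall>x\<in>{0<..<1}. 0 < w x \<and> (H has_real_derivative w x) (at x))"

lemma unit_reparam_less:
  assumes "unit_reparam H w" "0 \<le> x" "x < y" "y \<le> 1"
  shows "H x < H y"
proof (rule DERIV_pos_imp_increasing_open[OF assms(3)])
  show "\<exists>z. (H has_real_derivative z) (at t) \<and> 0 < z" if "x < t" "t < y" for t
    using assms that by (intro exI[of _ "w t"]) (auto simp: unit_reparam_def)
  show "continuous_on {x..y} H"
    using assms by (auto simp: unit_reparam_def intro: continuous_on_subset)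
qed

lemma unit_reparam_inj_on:
  assumes "unit_reparam H w"
  shows "inj_on H {0..1}"
proof (rule inj_onI)
  fix x y assume "x \<in> {0..1}" "y \<in> {0..1}" "H x = H y"
  then show "x = y"
    using unit_reparam_less[OF assms, of x y] unit_reparam_less[OF assms, of y x]
    by (cases rule: linorder_cases[of x y]) auto
qed

lemma unit_reparam_image:
  assumes H: "unit_reparam H w" and x: "0 \<le> x" "x \<le> 1"
  shows "H ` {0..x} = {0..H x}" "H ` {0<..<x} = {0<..<H x}"
proof -
  have 0: "H 0 = 0" using H by (simp add: unit_reparam_def)
  have mono: "H s \<le> H t" if "0 \<le> s" "s \<le> t" "t \<le> 1" for s t
    using unit_reparam_less[OF H, of s t] that by (cases "s = t") auto
  have ex: "\<exists>t\<in>{0..x}. y = H t" if "y \<in> {0..H x}" for y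
  proof -
    have "continuous_on {0..x} H"
      using H x by (auto simp: unit_reparam_def intro: continuous_on_subset)
    then show ?thesis using IVT'[of H 0 y x] that x 0 by auto
  qed
  show "H ` {0..x} = {0..H x}"
  proof (intro set_eqI iffI)
    fix y assume "y \<in> H ` {0..x}"
    then obtain t where "0 \<le> t" "t \<le> x" "y = H t" by auto
    then show "y \<in> {0..H x}" using mono[of 0 t] mono[of t x] x 0 by simp
  next
    fix y assume "y \<in> {0..H x}"
    then show "y \<in> H ` {0..x}" using ex by blast
  qed
  show "H ` {0<..<x} = {0<..<H x}"
  proof (intro set_eqI iffI)
    fix y assume "y \<in> H ` {0<..<x}"
    then obtain t where "0 < t" "t < x" "y = H t" by auto
    then show "y \<in> {0<..<H x}"
      using unit_reparam_less[OF H, of 0 t] unit_reparam_less[OF H, of t x] x 0 by simp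
  next
    fix y assume y: "y \<in> {0<..<H x}"
    then obtain t where t: "t \<in> {0..x}" "y = H t" using ex[of y] by auto
    with y 0 have "t \<noteq> 0" "t \<noteq> x" by auto
    with t show "y \<in> H ` {0<..<x}" by auto
  qed
qed

lemma unit_reparam_change_of_variables:
  fixes f :: "real \<Rightarrow> real"
  assumes H: "unit_reparam H w" and x: "0 \<le> x" "x \<le> 1"
  shows "(\<lambda>t. w t * f (H t)) absolutely_integrable_on {0<..<x} \<and>
      integral {0<..<x} (\<lambda>t. w t * f (H t)) = b \<longleftrightarrow>
    f absolutely_integrable_on {0<..<H x} \<and> integral {0<..<H x} f = b"
proof -
  have abs: "\<bar>w t\<bar> = w t" if "t \<in> {0<..<x}" for t
    using H x that by (intro abs_of_pos) (auto simp: unit_reparam_def)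
  have "(\<lambda>t. \<bar>w t\<bar> * f (H t)) absolutely_integrable_on {0<..<x} \<and>
      integral {0<..<x} (\<lambda>t. \<bar>w t\<bar> * f (H t)) = b \<longleftrightarrow>
    f absolutely_integrable_on (H ` {0<..<x}) \<and> integral (H ` {0<..<x}) f = b"
  proof (rule has_absolute_integral_change_of_variables_1')
    show "(H has_field_derivative w t) (at t within {0<..<x})" if "t \<in> {0<..<x}" for t
      using H x that by (auto simp: unit_reparam_def intro: has_field_derivative_at_within)
    show "inj_on H {0<..<x}"
      by (rule inj_on_subset[OF unit_reparam_inj_on[OF H]]) (use x in auto)
  qed simp
  moreover have "(\<lambda>t. \<bar>w t\<bar> * f (H t)) absolutely_integrable_on {0<..<x}
      \<longleftrightarrow> (\<lambda>t. w t * f (H t)) absolutely_integrable_on {0<..<x}"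
    by (rule set_integrable_cong) (auto simp: abs)
  moreover have "integral {0<..<x} (\<lambda>t. \<bar>w t\<bar> * f (H t)) = integral {0<..<x} (\<lambda>t. w t * f (H t))"
    by (rule integral_cong) (simp add: abs)
  ultimately show ?thesis by (simp add: unit_reparam_image(2)[OF H x])
qed

lemma unit_reparam_integrable_iff:
  fixes f :: "real \<Rightarrow> real"
  assumes H: "unit_reparam H w"
  shows "integrable unit_leb (\<lambda>t. w t * f (H t)) \<longleftrightarrow> integrable unit_leb f"
proof -
  have "H 1 = 1" using H by (simp add: unit_reparam_def)
  then show ?thesis
    using unit_reparam_change_of_variables[OF H, of 1 f] unfolding integrable_unit_leb_iff by auto
qed

lemma unit_reparam_LINT:
  fixes f :: "real \<Rightarrow> real"
  assumes H: "unit_reparam H w"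
  shows "(LINT t|unit_leb. w t * f (H t)) = (LINT y|unit_leb. f y)"
proof (cases "integrable unit_leb f")
  case True
  have "H 1 = 1" using H by (simp add: unit_reparam_def)
  then have "integral {0<..<1} (\<lambda>t. w t * f (H t)) = integral {0<..<1} f"
    using unit_reparam_change_of_variables[OF H, of 1 f] True unfolding integrable_unit_leb_iff by auto
  then show ?thesis
    using True unit_reparam_integrable_iff[OF H, of f] by (simp add: LINT_unit_leb_eq_integral)
next
  case False
  then show ?thesis
    \<comment> \<open>Both integrals have the default value 0.\<close>
    using unit_reparam_integrable_iff[OF H, of f] by (simp add: not_integrable_integral_eq)
qed

lemma unit_reparam_primitive:
  fixes f :: "real \<Rightarrow> real"
  assumes H: "unit_reparam H w" and f: "integrable unit_leb f" and x: "0 \<le> x" "x \<le> 1"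
  shows "integral {0..x} (\<lambda>t. w t * f (H t)) = integral {0..H x} f"
proof -
  have "H x \<le> 1" using unit_reparam_image(1)[OF H] x unit_reparam_less[OF H, of x 1] H
    by (cases "x = 1") (auto simp: unit_reparam_def)
  then have "f absolutely_integrable_on {0<..<H x}"
    by (intro set_integrable_subset[OF f[unfolded integrable_unit_leb_iff]]) auto
  then show ?thesis
    using unit_reparam_change_of_variables[OF H x, of f "integral {0<..<H x} f"]
    by (simp add: integral_open_interval_real)
qed

section \<open>Comparison of the eigenvalues\<close>

lemma L2_unit_mult_continuous:
  assumes g: "g \<in> L2_unit" and q: "continuous_on {0..1} q"
  shows "(\<lambda>x. g x * q x) \<in> L2_unit" "integrable unit_leb (\<lambda>x. (g x)\<^sup>2 * q x)"
proof -
  have g2: "integrable unit_leb (\<lambda>x. (g x)\<^sup>2)" using g by (simp add: L2_unit_def)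
  show "integrable unit_leb (\<lambda>x. (g x)\<^sup>2 * q x)"
    by (rule integrable_unit_leb_mult_continuous[OF g2 q])
  have "integrable unit_leb (\<lambda>x. (g x * q x)\<^sup>2)"
    using integrable_unit_leb_mult_continuous[OF g2 continuous_on_power[OF q, of 2]]
    by (simp add: power_mult_distrib)
  moreover have "integrable unit_leb (\<lambda>x. g x * q x)"
    by (rule integrable_unit_leb_mult_continuous[OF integrable_L2_unit[OF g] q])
  ultimately show "(\<lambda>x. g x * q x) \<in> L2_unit" by (auto simp: L2_unit_def)
qed

text \<open>
  With \<open>H'(x) = h(x) / M\<close> this says that \<open>k\<close> is the square of \<open>h\<close> in the variable
  \<open>y = H(x)\<close>. The relation is expressed in the variable \<open>x\<close>, which is the variable in
  which all integrals are computed.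
\<close>

definition weight_transport :: "real \<Rightarrow> (real \<Rightarrow> real) \<Rightarrow> (real \<Rightarrow> real) \<Rightarrow> (real \<Rightarrow> real) \<Rightarrow> bool"
  where "weight_transport M H h k \<longleftrightarrow> 0 < M \<and> unit_reparam H (\<lambda>x. h x / M) \<and>
    continuous_on {0..1} h \<and> continuous_on {0..1} k \<and> (\<forall>x\<in>{0..1}. k (H x) = (h x)\<^sup>2)"

lemma weight_transport_pos:
  assumes t: "weight_transport M H h k"
  shows "x \<in> {0<..<1} \<Longrightarrow> 0 < h x" "y \<in> {0<..<1} \<Longrightarrow> 0 \<le> k y"
    "x \<in> {0..1} \<Longrightarrow> 0 \<le> h x" "x \<in> {0..1} \<Longrightarrow> H x \<in> {0..1}"
proof -
  have H: "unit_reparam H (\<lambda>x. h x / M)" and M: "0 < M" and k: "\<forall>x\<in>{0..1}. k (H x) = (h x)\<^sup>2"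
    and cont: "continuous_on {0..1} h"
    using t by (auto simp: weight_transport_def)
  show pos: "0 < h x" if "x \<in> {0<..<1}" for x
    using H M that by (auto simp: unit_reparam_def zero_less_divide_iff)
  have H1: "H 1 = 1" using H by (simp add: unit_reparam_def)
  show "0 \<le> k y" if "y \<in> {0<..<1}"
  proof -
    have "H ` {0<..<1} = {0<..<1}" using unit_reparam_image(2)[OF H, of 1] H1 by simp
    with that obtain x where "x \<in> {0<..<1}" "y = H x" by (metis imageE)
    then show ?thesis using k by auto
  qed
  show "0 \<le> h x" if "x \<in> {0..1}"
  proof -
    have "x \<in> closure {0<..<1::real}" using that by simp
    then show ?thesis
      by (rule continuous_ge_on_closure[rotated]) (use cont pos in \<open>auto intro: less_imp_le\<close>)
  qed
  show "H x \<in> {0..1}" if "x \<in> {0..1}"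
    using unit_reparam_image(1)[OF H, of 1] H1 that by auto
qed

text \<open>
  A competitor \<open>v\<close> for \<open>sigma1 k\<close> gives the competitor \<open>u = v \<circ> H\<close> for
  \<open>mu1 h\<close>: since \<open>H' = h / M\<close> is bounded, \<open>u'\<close> is square integrable. The substitution
  \<open>y = H(x)\<close> multiplies the denominator by \<open>M\<close> and divides the numerator by \<open>M\<close>.
\<close>

lemma mu1_le_sigma1_transport:
  assumes t: "weight_transport M H h k"
  shows "M\<^sup>2 * mu1 h \<le> sigma1 k"
proof -
  have H: "unit_reparam H (\<lambda>x. h x / M)" and M: "0 < M" and k: "\<And>x. x \<in> {0..1} \<Longrightarrow> k (H x) = (h x)\<^sup>2"
    and hc: "continuous_on {0..1} h" and kc: "continuous_on {0..1} k"
    using t by (auto simp: weight_transport_def)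
  note pos = weight_transport_pos[OF t]
  note LINT_H = unit_reparam_LINT[OF H]
  show ?thesis
    unfolding sigma1_eq_rayleigh_inf
  proof (rule le_rayleigh_infI)
    fix c and g assume g: "g \<in> L2_unit" and mean: "(LINT x|unit_leb. (c + integral {0..x} g) * 1) = 0"
    define v where "v = (\<lambda>y. c + integral {0..y} g)"
    define u' where "u' = (\<lambda>x. h x / M * g (H x))"
    have gi: "integrable unit_leb g" by (rule integrable_L2_unit[OF g])
    have u'i: "integrable unit_leb u'"
      unfolding u'_def using unit_reparam_integrable_iff[OF H, of g] gi by simp
    have "integrable unit_leb (\<lambda>y. (g y)\<^sup>2 * (sqrt (k y) / M))"
      by (intro L2_unit_mult_continuous[OF g] continuous_intros kc) (use M in auto)
    then have "integrable unit_leb (\<lambda>x. h x / M * ((g (H x))\<^sup>2 * (sqrt (k (H x)) / M)))"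
      using unit_reparam_integrable_iff[OF H, of "\<lambda>y. (g y)\<^sup>2 * (sqrt (k y) / M)"] by simp
    moreover have "integrable unit_leb (\<lambda>x. h x / M * ((g (H x))\<^sup>2 * (sqrt (k (H x)) / M)))
        \<longleftrightarrow> integrable unit_leb (\<lambda>x. (u' x)\<^sup>2)"
      by (intro Bochner_Integration.integrable_cong refl)
         (use k pos(3) in \<open>auto simp: u'_def power2_eq_square\<close>)
    ultimately have u'L: "u' \<in> L2_unit" using u'i by (auto simp: L2_unit_def)
    have u: "c + integral {0..x} u' = v (H x)" if "x \<in> {0..1}" for x
      using unit_reparam_primitive[OF H gi] that by (simp add: u'_def v_def)
    have "(LINT x|unit_leb. (c + integral {0..x} u') * h x) = (LINT x|unit_leb. M * (h x / M * v (H x)))"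
      by (rule Bochner_Integration.integral_cong) (use u M in auto)
    also have "\<dots> = M * (LINT y|unit_leb. v y)"
      by (simp only: integral_mult_right_zero LINT_H[of v])
    finally have mean': "(LINT x|unit_leb. (c + integral {0..x} u') * h x) = 0"
      using mean by (simp add: v_def)
    have den: "(LINT x|unit_leb. (c + integral {0..x} u')\<^sup>2 * h x) = M * (LINT y|unit_leb. (v y)\<^sup>2)"
    proof -
      have "(LINT x|unit_leb. (c + integral {0..x} u')\<^sup>2 * h x)
          = (LINT x|unit_leb. M * (h x / M * (v (H x))\<^sup>2))"
        by (rule Bochner_Integration.integral_cong) (use u M in auto)
      also have "\<dots> = M * (LINT y|unit_leb. (v y)\<^sup>2)"
        by (simp only: integral_mult_right_zero LINT_H[of "\<lambda>y. (v y)\<^sup>2"])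
      finally show ?thesis .
    qed
    have num: "(LINT x|unit_leb. (u' x)\<^sup>2 * h x) = (LINT y|unit_leb. (g y)\<^sup>2 * k y) / M"
    proof -
      have "(LINT x|unit_leb. (u' x)\<^sup>2 * h x)
          = (LINT x|unit_leb. (h x / M * ((g (H x))\<^sup>2 * k (H x))) / M)"
        by (rule Bochner_Integration.integral_cong) (use k in \<open>auto simp: u'_def power2_eq_square\<close>)
      also have "\<dots> = (LINT y|unit_leb. (g y)\<^sup>2 * k y) / M"
        by (simp only: integral_divide_zero LINT_H[of "\<lambda>y. (g y)\<^sup>2 * k y"])
      finally show ?thesis .
    qed
    have "mu1 h * (LINT x|unit_leb. (c + integral {0..x} u')\<^sup>2 * h x) \<le> (LINT x|unit_leb. (u' x)\<^sup>2 * h x)"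
      unfolding mu1_eq_rayleigh_inf
      by (rule rayleigh_inf_le[OF hc pos(1) less_imp_le[OF pos(1)] u'L mean'])
    then have "mu1 h * (M * (LINT y|unit_leb. (v y)\<^sup>2)) \<le> (LINT y|unit_leb. (g y)\<^sup>2 * k y) / M"
      by (simp add: num den)
    then have "mu1 h * (M * (LINT y|unit_leb. (v y)\<^sup>2)) * M \<le> (LINT y|unit_leb. (g y)\<^sup>2 * k y)"
      using M by (simp add: pos_le_divide_eq)
    then show "M\<^sup>2 * mu1 h * (LINT x|unit_leb. (c + integral {0..x} g)\<^sup>2 * 1)
        \<le> (LINT x|unit_leb. (g x)\<^sup>2 * k x)"
      by (simp add: v_def power2_eq_square mult_ac)
  qed (use pos(2) in auto)
qed

text \<open>
  The converse composition, of \<open>u\<close> with the inverse of \<open>H\<close>, may leave \<open>H\<^sup>1\<close>: its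
  derivative is \<open>M u' / h\<close> in the variable \<open>x\<close>, and \<open>h\<close> may vanish at the endpoints.
  Replacing \<open>u'\<close> by \<open>u' h / (h + e)\<close> bounds the derivative by a multiple of \<open>u'\<close>
  and does not increase the numerator. The function \<open>u\<close> below is the regularised one; its
  weighted mean \<open>m\<close> is subtracted to restore the orthogonality condition.
\<close>

lemma sigma1_transport_regularised:
  fixes c :: real and g :: "real \<Rightarrow> real"
  assumes t: "weight_transport M H h k"
    and g: "g \<in> L2_unit" and e: "0 < e"
  defines "u \<equiv> \<lambda>x. c + integral {0..x} (\<lambda>t. g t * (h t / (h t + e)))"
  defines "m \<equiv> LINT x|unit_leb. u x * (h x / M)"
  shows "sigma1 k * (LINT x|unit_leb. (u x - m)\<^sup>2 * (h x / M)) \<le> M * (LINT x|unit_leb. (g x)\<^sup>2 * h x)"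
proof -
  have H: "unit_reparam H (\<lambda>x. h x / M)" and M: "0 < M" and k: "\<And>x. x \<in> {0..1} \<Longrightarrow> k (H x) = (h x)\<^sup>2"
    and hc: "continuous_on {0..1} h" and kc: "continuous_on {0..1} k"
    using t by (auto simp: weight_transport_def)
  note pos = weight_transport_pos[OF t]
  note LINT_H = unit_reparam_LINT[OF H]
  define X where "X = the_inv_into {0..1} H"
  have X: "X (H x) = x" if "x \<in> {0..1}" for x
    unfolding X_def by (rule the_inv_into_f_f[OF unit_reparam_inj_on[OF H] that])
  have e': "h x + e > 0" if "x \<in> {0..1}" for x using pos(3)[OF that] e by linarith
  then have ne: "\<forall>x\<in>{0..1}. h x + e \<noteq> 0" by force
  define v' where "v' = (\<lambda>y. M * g (X y) / (h (X y) + e))"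
  \<comment> \<open>Pulled back along \<open>H\<close>, the derivative \<open>v'\<close> is the regularised one of \<open>u\<close>.\<close>
  have pull: "h x / M * v' (H x) = g x * (h x / (h x + e))" if "x \<in> {0..1}" for x
    using that M by (simp add: v'_def X)
  have v'i: "integrable unit_leb v'"
  proof -
    have "integrable unit_leb (\<lambda>x. g x * (h x / (h x + e)))"
      by (intro integrable_unit_leb_mult_continuous integrable_L2_unit[OF g] continuous_intros hc ne)
    moreover have "integrable unit_leb (\<lambda>x. h x / M * v' (H x)) \<longleftrightarrow> integrable unit_leb (\<lambda>x. g x * (h x / (h x + e)))"
      by (intro Bochner_Integration.integrable_cong refl) (use pull in auto)
    ultimately show ?thesis using unit_reparam_integrable_iff[OF H, of v'] by simp
  qed
  have v'L: "v' \<in> L2_unit"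
  proof -
    have "integrable unit_leb (\<lambda>x. (g x)\<^sup>2 * (M * h x / (h x + e)\<^sup>2))"
      by (intro L2_unit_mult_continuous[OF g] continuous_intros hc) (use ne in auto)
    moreover have "integrable unit_leb (\<lambda>x. h x / M * (v' (H x))\<^sup>2)
        \<longleftrightarrow> integrable unit_leb (\<lambda>x. (g x)\<^sup>2 * (M * h x / (h x + e)\<^sup>2))"
      by (intro Bochner_Integration.integrable_cong refl)
         (use M in \<open>auto simp: v'_def X power2_eq_square\<close>)
    ultimately have "integrable unit_leb (\<lambda>y. (v' y)\<^sup>2)"
      using unit_reparam_integrable_iff[OF H, of "\<lambda>y. (v' y)\<^sup>2"] by blast
    then show ?thesis using v'i by (auto simp: L2_unit_def)
  qed
  define V where "V = (\<lambda>y. c - m + integral {0..y} v')"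
  have V: "V (H x) = u x - m" if "x \<in> {0..1}" for x
  proof -
    have "integral {0..x} (\<lambda>t. h t / M * v' (H t)) = integral {0..H x} v'"
      using unit_reparam_primitive[OF H v'i, of x] that by simp
    moreover have "integral {0..x} (\<lambda>t. h t / M * v' (H t)) = integral {0..x} (\<lambda>t. g t * (h t / (h t + e)))"
      by (rule integral_cong) (use that pull in auto)
    ultimately show ?thesis by (simp add: V_def u_def)
  qed
  have uc: "continuous_on {0..1} u"
    unfolding u_def
    by (intro continuous_on_primitive integrable_unit_leb_mult_continuous integrable_L2_unit[OF g]
        continuous_intros hc ne)
  have mass: "(LINT x|unit_leb. h x / M) = 1"
    using LINT_H[of "\<lambda>_. 1"] by (simp add: measure_unit_leb)
  have wi: "integrable unit_leb (\<lambda>x. h x / M)" "integrable unit_leb (\<lambda>x. u x * (h x / M))"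
    by (intro integrable_unit_leb_continuous continuous_intros hc uc; use M in simp)+
  have "(LINT y|unit_leb. V y) = (LINT x|unit_leb. h x / M * V (H x))"
    by (rule LINT_H[symmetric])
  also have "\<dots> = (LINT x|unit_leb. u x * (h x / M) - m * (h x / M))"
    by (rule Bochner_Integration.integral_cong) (auto simp: V algebra_simps diff_divide_distrib)
  also have "\<dots> = (LINT x|unit_leb. u x * (h x / M)) - m * (LINT x|unit_leb. h x / M)"
    by (subst Bochner_Integration.integral_diff[OF wi(2) integrable_mult_right[OF wi(1)]])
       (simp only: integral_mult_right_zero)
  also have "\<dots> = 0" by (simp only: mass mult_1_right m_def[symmetric] diff_self)
  finally have mean: "(LINT y|unit_leb. V y) = 0" .
  have den: "(LINT y|unit_leb. (V y)\<^sup>2) = (LINT x|unit_leb. (u x - m)\<^sup>2 * (h x / M))"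
  proof -
    have "(LINT y|unit_leb. (V y)\<^sup>2) = (LINT x|unit_leb. h x / M * (V (H x))\<^sup>2)"
      by (rule LINT_H[symmetric])
    also have "\<dots> = (LINT x|unit_leb. (u x - m)\<^sup>2 * (h x / M))"
      by (rule Bochner_Integration.integral_cong) (auto simp: V)
    finally show ?thesis .
  qed
  have num: "(LINT y|unit_leb. (v' y)\<^sup>2 * k y) \<le> M * (LINT x|unit_leb. (g x)\<^sup>2 * h x)"
  proof -
    have "(LINT y|unit_leb. (v' y)\<^sup>2 * k y) = (LINT x|unit_leb. h x / M * ((v' (H x))\<^sup>2 * k (H x)))"
      by (rule LINT_H[symmetric])
    also have "\<dots> = (LINT x|unit_leb. (g x)\<^sup>2 * (M * h x * (h x / (h x + e))\<^sup>2))"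
      by (rule Bochner_Integration.integral_cong) (use M in \<open>auto simp: v'_def X k power2_eq_square\<close>)
    also have "\<dots> \<le> (LINT x|unit_leb. (g x)\<^sup>2 * (M * h x))"
    proof (rule integral_mono)
      show "integrable unit_leb (\<lambda>x. (g x)\<^sup>2 * (M * h x * (h x / (h x + e))\<^sup>2))"
        by (intro L2_unit_mult_continuous[OF g] continuous_intros hc ne)
      show "integrable unit_leb (\<lambda>x. (g x)\<^sup>2 * (M * h x))"
        by (intro L2_unit_mult_continuous[OF g] continuous_intros hc)
      fix x assume "x \<in> space unit_leb"
      then have x: "0 < h x" using pos(1) by simp
      then have "(h x / (h x + e))\<^sup>2 \<le> 1" using e by (intro power_le_one) auto
      then show "(g x)\<^sup>2 * (M * h x * (h x / (h x + e))\<^sup>2) \<le> (g x)\<^sup>2 * (M * h x)"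
        using x M by (intro mult_left_mono mult_left_le) auto
    qed
    also have "\<dots> = M * (LINT x|unit_leb. (g x)\<^sup>2 * h x)"
      by (simp add: mult.left_commute)
    finally show ?thesis .
  qed
  have "sigma1 k * (LINT y|unit_leb. (V y)\<^sup>2) \<le> (LINT y|unit_leb. (v' y)\<^sup>2 * k y)"
    using rayleigh_inf_le[OF continuous_on_const zero_less_one pos(2) v'L, where c="c - m"] mean
    by (simp add: sigma1_eq_rayleigh_inf V_def)
  with num show ?thesis by (simp add: den)
qed

text \<open>
  Let \<open>e\<close> tend to zero in the regularised inequality. The regularised functions converge
  pointwise and boundedly to the given one because \<open>h\<close> is positive in the open interval, so
  their means tend to zero and the denominators converge.
\<close>

lemma sigma1_transport_le_mu1:
  assumes t: "weight_transport M H h k"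
  shows "sigma1 k \<le> M\<^sup>2 * mu1 h"
proof -
  have M: "0 < M" and hc: "continuous_on {0..1} h"
    using t by (auto simp: weight_transport_def)
  note pos = weight_transport_pos[OF t]
  have "sigma1 k / M\<^sup>2 \<le> mu1 h"
    unfolding mu1_eq_rayleigh_inf
  proof (rule le_rayleigh_infI[OF hc pos(1) less_imp_le[OF pos(1)]])
    fix c and g assume g: "g \<in> L2_unit" and mean: "(LINT x|unit_leb. (c + integral {0..x} g) * h x) = 0"
    have gi: "integrable unit_leb g" by (rule integrable_L2_unit[OF g])
    define e where "e n = inverse (real (Suc n))" for n
    have e: "0 < e n" for n by (simp add: e_def)
    have elim: "e \<longlonglongrightarrow> 0" unfolding e_def by (rule LIMSEQ_inverse_real_of_nat)
    define q where "q n t = h t / (h t + e n)" for n t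
    define U where "U x = c + integral {0..x} g" for x
    define u where "u n x = c + integral {0..x} (\<lambda>t. g t * q n t)" for n x
    define m where "m n = (LINT x|unit_leb. u n x * (h x / M))" for n
    have q01: "0 \<le> q n t" "q n t \<le> 1" if "t \<in> {0..1}" for n t
      using pos(3)[OF that] e[of n] by (auto simp: q_def)
    have qc: "continuous_on {0..1} (q n)" for n
      unfolding q_def using pos(3) e[of n] by (intro continuous_intros hc) force
    have gq: "integrable unit_leb (\<lambda>t. g t * q n t)" for n
      by (rule integrable_unit_leb_mult_continuous[OF gi qc])
    have uc: "continuous_on {0..1} (u n)" for n
      unfolding u_def by (rule continuous_on_primitive[OF gq])
    have Uc: "continuous_on {0..1} U"
      unfolding U_def by (rule continuous_on_primitive[OF gi])
    have absg: "integrable unit_leb (\<lambda>t. \<bar>g t\<bar>)" using gi by simp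
    have ulim: "(\<lambda>n. u n x) \<longlonglongrightarrow> U x" if x: "x \<in> {0<..<1}" for x
    proof -
      have "(\<lambda>n. integral {0<..<x} (\<lambda>t. g t * q n t)) \<longlonglongrightarrow> integral {0<..<x} g"
      proof (rule dominated_convergence(2)[where h="\<lambda>t. \<bar>g t\<bar>"])
        show "(\<lambda>t. g t * q n t) integrable_on {0<..<x}" for n
          using integrable_on_closed_unit[OF gq, of 0 x n] x by (simp add: integrable_on_open_interval_real)
        show "(\<lambda>t. \<bar>g t\<bar>) integrable_on {0<..<x}"
          using integrable_on_closed_unit[OF absg, of 0 x] x by (simp add: integrable_on_open_interval_real)
        show "norm (g t * q n t) \<le> \<bar>g t\<bar>" if "t \<in> {0<..<x}" for t n
          using q01[of t n] that x by (simp add: abs_mult mult_left_le)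
        show "(\<lambda>n. g t * q n t) \<longlonglongrightarrow> g t" if "t \<in> {0<..<x}" for t
        proof -
          have "0 < h t" using pos(1)[of t] that x by simp
          then have "(\<lambda>n. g t * q n t) \<longlonglongrightarrow> g t * (h t / (h t + 0))"
            unfolding q_def by (intro tendsto_intros elim) auto
          then show ?thesis using \<open>0 < h t\<close> by simp
        qed
      qed
      then show ?thesis
        unfolding u_def U_def by (intro tendsto_intros) (simp add: integral_open_interval_real)
    qed
    define B where "B = \<bar>c\<bar> + integral {0..1} (\<lambda>t. \<bar>g t\<bar>)"
    have ub: "\<bar>u n x\<bar> \<le> B" if x: "x \<in> {0<..<1}" for n x
    proof -
      have "\<bar>integral {0..x} (\<lambda>t. g t * q n t)\<bar> \<le> integral {0..x} (\<lambda>t. \<bar>g t\<bar>)"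
        using integral_norm_bound_integral[of "\<lambda>t. g t * q n t" "{0..x}" "\<lambda>t. \<bar>g t\<bar>"]
          integrable_on_closed_unit[OF gq, of 0 x n] integrable_on_closed_unit[OF absg, of 0 x] q01 x
        by (simp add: abs_mult mult_left_le)
      also have "\<dots> \<le> integral {0..1} (\<lambda>t. \<bar>g t\<bar>)"
        by (intro integral_subset_le integrable_on_closed_unit[OF absg]) (use x in auto)
      finally show ?thesis unfolding u_def B_def by linarith
    qed
    have meas: "(\<lambda>x. f (u n x) * (h x / M)) \<in> borel_measurable unit_leb"
      if "continuous_on UNIV f" for f :: "real \<Rightarrow> real" and n
    proof -
      have "continuous_on {0..1} (\<lambda>x. f (u n x) * (h x / M))"
        using M by (intro continuous_intros hc continuous_on_compose2[OF that uc]) auto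
      then show ?thesis using integrable_unit_leb_continuous by auto
    qed
    have bi: "integrable unit_leb (\<lambda>x. C * (h x / M))" for C
      using M by (intro integrable_unit_leb_continuous continuous_intros hc) auto
    have hM: "0 \<le> h x / M" if "x \<in> {0<..<1}" for x using pos(1)[OF that] M by simp
    have mlim: "m \<longlonglongrightarrow> 0"
    proof -
      have "(\<lambda>n. LINT x|unit_leb. u n x * (h x / M)) \<longlonglongrightarrow> (LINT x|unit_leb. U x * (h x / M))"
      proof (rule integral_dominated_convergence[where w="\<lambda>x. B * (h x / M)"])
        show "(\<lambda>x. u n x * (h x / M)) \<in> borel_measurable unit_leb" for n
          using meas[OF continuous_on_id] by simp
        have "continuous_on {0..1} (\<lambda>x. U x * (h x / M))"
          using M by (intro continuous_intros hc Uc) auto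
        then show "(\<lambda>x. U x * (h x / M)) \<in> borel_measurable unit_leb"
          using integrable_unit_leb_continuous by auto
        show "AE x in unit_leb. (\<lambda>n. u n x * (h x / M)) \<longlonglongrightarrow> U x * (h x / M)"
          by (intro AE_I2 tendsto_intros ulim) auto
        show "AE x in unit_leb. norm (u n x * (h x / M)) \<le> B * (h x / M)" for n
        proof (intro AE_I2)
          fix x assume "x \<in> space unit_leb"
          then have x: "x \<in> {0<..<1}" by simp
          show "norm (u n x * (h x / M)) \<le> B * (h x / M)"
            unfolding real_norm_def abs_mult abs_of_nonneg[OF hM[OF x]]
            by (rule mult_right_mono[OF ub[OF x] hM[OF x]])
        qed
      qed (rule bi)
      moreover have "(LINT x|unit_leb. U x * (h x / M)) = 0"
        using mean by (simp add: U_def)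
      moreover have "m = (\<lambda>n. LINT x|unit_leb. u n x * (h x / M))"
        by (simp add: m_def fun_eq_iff)
      ultimately show ?thesis by (simp only:)
    qed
    then have "Bseq m" using convergentI convergent_imp_Bseq by blast
    then obtain K where K: "\<bar>m n\<bar> \<le> K" for n
      unfolding Bseq_def real_norm_def by blast
    have den: "(\<lambda>n. LINT x|unit_leb. (u n x - m n)\<^sup>2 * (h x / M)) \<longlonglongrightarrow> (LINT x|unit_leb. (U x)\<^sup>2 * (h x / M))"
    proof (rule integral_dominated_convergence[where w="\<lambda>x. (B + K)\<^sup>2 * (h x / M)"])
      show "(\<lambda>x. (u n x - m n)\<^sup>2 * (h x / M)) \<in> borel_measurable unit_leb" for n
        by (rule meas) (intro continuous_intros)
      have "continuous_on {0..1} (\<lambda>x. (U x)\<^sup>2 * (h x / M))"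
        using M by (intro continuous_intros hc Uc) auto
      then show "(\<lambda>x. (U x)\<^sup>2 * (h x / M)) \<in> borel_measurable unit_leb"
        using integrable_unit_leb_continuous by auto
      show "AE x in unit_leb. (\<lambda>n. (u n x - m n)\<^sup>2 * (h x / M)) \<longlonglongrightarrow> (U x)\<^sup>2 * (h x / M)"
      proof (intro AE_I2)
        fix x assume "x \<in> space unit_leb"
        then have "(\<lambda>n. (u n x - m n)\<^sup>2 * (h x / M)) \<longlonglongrightarrow> (U x - 0)\<^sup>2 * (h x / M)"
          by (intro tendsto_intros ulim mlim) auto
        then show "(\<lambda>n. (u n x - m n)\<^sup>2 * (h x / M)) \<longlonglongrightarrow> (U x)\<^sup>2 * (h x / M)" by simp
      qed
      show "AE x in unit_leb. norm ((u n x - m n)\<^sup>2 * (h x / M)) \<le> (B + K)\<^sup>2 * (h x / M)" for n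
      proof (intro AE_I2)
        fix x assume "x \<in> space unit_leb"
        then have x: "x \<in> {0<..<1}" by simp
        have "\<bar>u n x - m n\<bar> \<le> \<bar>B + K\<bar>" using ub[OF x, of n] K[of n] by linarith
        then have "(u n x - m n)\<^sup>2 \<le> (B + K)\<^sup>2" by (simp add: abs_le_square_iff)
        then show "norm ((u n x - m n)\<^sup>2 * (h x / M)) \<le> (B + K)\<^sup>2 * (h x / M)"
          using mult_right_mono[OF _ hM[OF x]] hM[OF x] by (simp only: real_norm_def abs_mult abs_power2 abs_of_nonneg)
      qed
    qed (rule bi)
    have "sigma1 k * (LINT x|unit_leb. (U x)\<^sup>2 * (h x / M)) \<le> M * (LINT x|unit_leb. (g x)\<^sup>2 * h x)"
    proof (rule LIMSEQ_le_const2[OF tendsto_mult_left[OF den]])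
      show "\<exists>N. \<forall>n\<ge>N. sigma1 k * (LINT x|unit_leb. (u n x - m n)\<^sup>2 * (h x / M))
          \<le> M * (LINT x|unit_leb. (g x)\<^sup>2 * h x)"
        using sigma1_transport_regularised[OF t g e, of c] unfolding u_def m_def q_def by blast
    qed
    then show "sigma1 k / M\<^sup>2 * (LINT x|unit_leb. (c + integral {0..x} g)\<^sup>2 * h x)
        \<le> (LINT x|unit_leb. (g x)\<^sup>2 * h x)"
      using M by (simp add: U_def power2_eq_square field_simps)
  qed
  then show ?thesis using M by (simp add: pos_divide_le_eq mult.commute)
qed

lemma transport_eigenvalues:
  "weight_transport M H h k \<Longrightarrow> M\<^sup>2 * mu1 h = sigma1 k"
  by (intro antisym mu1_le_sigma1_transport sigma1_transport_le_mu1)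

section \<open>Concavity under a change of variable\<close>

text \<open>
  Cut \<open>[a, b]\<close> into pieces shorter than \<open>d\<close> and add up the increments.
\<close>

lemma le_if_increments_small:
  fixes D :: "real \<Rightarrow> real"
  assumes ab: "a \<le> b"
    and small: "\<And>e. 0 < e \<Longrightarrow> \<exists>d>0. \<forall>s t. a \<le> s \<and> s \<le> t \<and> t \<le> b \<and> t - s < d \<longrightarrow> D t - D s \<le> e * (t - s)"
  shows "D b \<le> D a"
proof -
  have *: "D b - D a \<le> e * (b - a)" if e: "0 < e" for e
  proof -
    obtain d where d: "0 < d"
      "\<And>s t. a \<le> s \<Longrightarrow> s \<le> t \<Longrightarrow> t \<le> b \<Longrightarrow> t - s < d \<Longrightarrow> D t - D s \<le> e * (t - s)"
      using small[OF e] by blast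
    obtain n where n: "(b - a) / d < real n" using reals_Archimedean2 by blast
    then have n0: "0 < n" using ab d(1) by (metis divide_nonneg_pos diff_ge_0_iff_ge gr0I not_less of_nat_0)
    define r where "r = (b - a) / n"
    have r: "0 \<le> r" "r < d" "n * r = b - a"
      using ab n n0 d(1) by (auto simp: r_def field_simps)
    have "D b - D a = (\<Sum>i<n. D (a + Suc i * r) - D (a + i * r))"
      using sum_lessThan_telescope[of "\<lambda>i. D (a + real i * r)" n] r(3) by simp
    also have "\<dots> \<le> (\<Sum>i<n. e * r)"
    proof (rule sum_mono)
      fix i assume "i \<in> {..<n}"
      then have "real (Suc i) * r \<le> real n * r" by (intro mult_right_mono r) auto
      then have "D (a + Suc i * r) - D (a + i * r) \<le> e * (a + Suc i * r - (a + i * r))"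
        using r by (intro d(2)) (auto simp: algebra_simps)
      then show "D (a + Suc i * r) - D (a + i * r) \<le> e * r" by (simp add: algebra_simps)
    qed
    also have "\<dots> = e * (b - a)" using r(3) by (simp add: mult.left_commute)
    finally show ?thesis .
  qed
  show ?thesis
  proof (cases "a = b")
    case False
    show ?thesis
    proof (rule field_le_epsilon)
      fix e :: real assume "0 < e"
      then have "D b - D a \<le> e / (b - a) * (b - a)" using ab False by (intro *) simp
      also have "\<dots> = e" using False by simp
      finally show "D b \<le> D a + e" by simp
    qed
  qed simp
qed

text \<open>
  Formally \<open>d\<Phi>(f) = \<phi>(f) df \<le> p \<phi>(f) dt = p dI\<close>. As \<open>f\<close> need not be
  differentiable, increments over short intervals \<open>[s, t]\<close> are compared instead. The mean value
  theorem writes those of \<open>\<Phi> \<circ> f\<close> and of \<open>I\<close> with values of \<open>\<phi> \<circ> f\<close> at two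
  points \<open>x\<close> and \<open>z\<close> of \<open>[s, t]\<close>, and uniform continuity makes these values close.
\<close>

lemma increment_le_of_chain_rule:
  fixes f I \<Phi> \<phi> :: "real \<Rightarrow> real"
  assumes ab: "a \<le> b" and fc: "continuous_on {a..b} f"
    and gc: "continuous_on {a..b} (\<lambda>t. \<phi> (f t))"
    and I: "\<And>t. t \<in> {a..b} \<Longrightarrow> (I has_real_derivative \<phi> (f t)) (at t)"
    and \<Phi>: "\<And>t. t \<in> {a..b} \<Longrightarrow> (\<Phi> has_real_derivative \<phi> (f t)) (at (f t))"
    and nn: "\<And>t. t \<in> {a..b} \<Longrightarrow> 0 \<le> \<phi> (f t)"
    and incr: "\<And>s t. a \<le> s \<Longrightarrow> s \<le> t \<Longrightarrow> t \<le> b \<Longrightarrow> f t - f s \<le> p * (t - s)"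
  shows "\<Phi> (f b) - \<Phi> (f a) \<le> p * (I b - I a)"
proof -
  define D where "D t = \<Phi> (f t) - p * I t" for t
  have "D b \<le> D a"
  proof (rule le_if_increments_small[OF ab])
    fix e :: real assume e: "0 < e"
    \<comment> \<open>The oscillation of \<open>\<phi> \<circ> f\<close> is multiplied by \<open>p\<close> at the end, whence the denominator.\<close>
    have e': "0 < e / (\<bar>p\<bar> + 1)" using e by simp
    have "uniformly_continuous_on {a..b} (\<lambda>t. \<phi> (f t))"
      by (rule compact_uniformly_continuous[OF gc]) simp
    then obtain d where d: "0 < d" "\<And>s t. s \<in> {a..b} \<Longrightarrow> t \<in> {a..b} \<Longrightarrow> \<bar>t - s\<bar> < d
        \<Longrightarrow> \<bar>\<phi> (f t) - \<phi> (f s)\<bar> < e / (\<bar>p\<bar> + 1)"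
      unfolding uniformly_continuous_on_def dist_real_def using e' by metis
    have "D t - D s \<le> e * (t - s)" if st: "a \<le> s" "s \<le> t" "t \<le> b" "t - s < d" for s t
    proof (cases "s = t")
      case False
      then have lt: "s < t" using st by simp
      have sub: "{s..t} \<subseteq> {a..b}" using st by auto
      obtain z where z: "s < z" "z < t" "I t - I s = (t - s) * \<phi> (f z)"
        using MVT2[OF lt, of I "\<lambda>t. \<phi> (f t)"] I sub by force
      have conn: "connected (f ` {s..t})"
        using fc sub by (intro connected_continuous_image) (auto intro: continuous_on_subset)
      have "\<exists>x\<in>{s..t}. \<Phi> (f t) - \<Phi> (f s) = (f t - f s) * \<phi> (f x)"
      proof (cases "f s" "f t" rule: linorder_cases)
        case less
        have "{f s..f t} \<subseteq> f ` {s..t}"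
          by (rule connected_contains_Icc[OF conn]) (use lt in auto)
        then have "\<exists>y>f s. y < f t \<and> \<Phi> (f t) - \<Phi> (f s) = (f t - f s) * \<phi> y"
          using MVT2[OF less, of \<Phi> \<phi>] \<Phi> sub by (force simp: subset_iff image_iff)
        then obtain y where "f s < y" "y < f t" "\<Phi> (f t) - \<Phi> (f s) = (f t - f s) * \<phi> y" by blast
        moreover from this have "y \<in> f ` {s..t}" using \<open>{f s..f t} \<subseteq> f ` {s..t}\<close> by auto
        ultimately show ?thesis by auto
      next
        case greater
        have "{f t..f s} \<subseteq> f ` {s..t}"
          by (rule connected_contains_Icc[OF conn]) (use lt in auto)
        then have "\<exists>y>f t. y < f s \<and> \<Phi> (f s) - \<Phi> (f t) = (f s - f t) * \<phi> y"
          using MVT2[OF greater, of \<Phi> \<phi>] \<Phi> sub by (force simp: subset_iff image_iff)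
        then obtain y where "f t < y" "y < f s" "\<Phi> (f s) - \<Phi> (f t) = (f s - f t) * \<phi> y" by blast
        then have "\<Phi> (f t) - \<Phi> (f s) = (f t - f s) * \<phi> y" by (simp add: algebra_simps)
        moreover have "y \<in> f ` {s..t}"
          using \<open>{f t..f s} \<subseteq> f ` {s..t}\<close> \<open>f t < y\<close> \<open>y < f s\<close> by auto
        ultimately show ?thesis by auto
      qed (use lt in auto)
      then obtain x where x: "x \<in> {s..t}" "\<Phi> (f t) - \<Phi> (f s) = (f t - f s) * \<phi> (f x)" by blast
      have "\<Phi> (f t) - \<Phi> (f s) \<le> p * (t - s) * \<phi> (f x)"
        unfolding x(2) by (intro mult_right_mono incr st nn) (use x sub in auto)
      moreover have "D t - D s = \<Phi> (f t) - \<Phi> (f s) - p * ((t - s) * \<phi> (f z))"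
        unfolding z(3)[symmetric] by (simp add: D_def algebra_simps)
      ultimately have "D t - D s \<le> p * (\<phi> (f x) - \<phi> (f z)) * (t - s)"
        by (simp add: algebra_simps)
      also have "\<dots> \<le> e * (t - s)"
      proof (rule mult_right_mono)
        have "\<bar>\<phi> (f x) - \<phi> (f z)\<bar> < e / (\<bar>p\<bar> + 1)"
          by (rule d(2)) (use x z st in auto)
        then have "\<bar>p\<bar> * \<bar>\<phi> (f x) - \<phi> (f z)\<bar> \<le> (\<bar>p\<bar> + 1) * (e / (\<bar>p\<bar> + 1))"
          by (intro mult_mono) auto
        then show "p * (\<phi> (f x) - \<phi> (f z)) \<le> e"
          using abs_ge_self[of "p * (\<phi> (f x) - \<phi> (f z))"] by (simp add: abs_mult)
      qed (use st in simp)
      finally show ?thesis .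
    qed simp
    with d(1) show "\<exists>d>0. \<forall>s t. a \<le> s \<and> s \<le> t \<and> t \<le> b \<and> t - s < d \<longrightarrow> D t - D s \<le> e * (t - s)"
      by blast
  qed
  then show ?thesis by (simp add: D_def algebra_simps)
qed

lemma concave_on_supergradient:
  fixes f :: "real \<Rightarrow> real"
  assumes "concave_on {0..1} f" "x0 \<in> {0<..<1}"
  shows "\<exists>p. \<forall>x\<in>{0..1}. f x \<le> f x0 + p * (x - x0)"
proof -
  have "x0 \<in> interior {0..1}" using assms by simp
  from convex_le_Inf_differential[OF assms(1)[unfolded concave_on_def] this]
  obtain c where "\<And>y. y \<in> {0..1} \<Longrightarrow> - f y \<ge> - f x0 + c * (y - x0)" by blast
  then show ?thesis by (intro exI[of _ "- c"]) (force simp: algebra_simps)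
qed

text \<open>
  By continuity a supergradient inequality on the open interval extends to the endpoints; taken at
  a convex combination \<open>z\<close> of \<open>x\<close> and \<open>y\<close>, it bounds the values at \<open>x\<close> and \<open>y\<close>
  by an affine function that agrees with \<open>f\<close> at \<open>z\<close>.
\<close>

lemma concave_on_if_supergradients:
  fixes f :: "real \<Rightarrow> real"
  assumes fc: "continuous_on {0..1} f"
    and sg: "\<And>x0. x0 \<in> {0<..<1} \<Longrightarrow> \<exists>p. \<forall>x\<in>{0<..<1}. f x \<le> f x0 + p * (x - x0)"
  shows "concave_on {0..1} f"
proof (rule concave_on_linorderI)
  fix t x y :: real
  assume t: "0 < t" "t < 1" and xy: "x \<in> {0..1}" "y \<in> {0..1}" "x < y"
  define z where "z = (1 - t) * x + t * y"
  have z: "x < z" "z < y"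
  proof -
    have "z - x = t * (y - x)" "y - z = (1 - t) * (y - x)" by (auto simp: z_def algebra_simps)
    then show "x < z" "z < y" using t xy by (metis diff_gt_0_iff_gt mult_pos_pos)+
  qed
  then have "z \<in> {0<..<1}" using xy by auto
  then obtain p where p: "\<And>x. x \<in> {0<..<1} \<Longrightarrow> f x \<le> f z + p * (x - z)" using sg by blast
  have p': "f x \<le> f z + p * (x - z)" if "x \<in> {0..1}" for x
  proof -
    have "f x - (f z + p * (x - z)) \<le> 0"
    proof (rule continuous_le_on_closure[where S="{0<..<1}" and f="\<lambda>x. f x - (f z + p * (x - z))" and x=x])
      show "x \<in> closure {0<..<1}" using that by simp
      show "continuous_on (closure {0<..<1}) (\<lambda>x. f x - (f z + p * (x - z)))"
        using fc by (auto intro!: continuous_intros)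
    qed (use p in force)
    then show ?thesis by simp
  qed
  have "(1 - t) * f x + t * f y \<le> (1 - t) * (f z + p * (x - z)) + t * (f z + p * (y - z))"
    using t xy by (intro add_mono mult_left_mono p') auto
  also have "\<dots> = f z + p * ((1 - t) * x + t * y - z)" by (simp add: algebra_simps)
  finally show "(1 - t) * f x + t * f y \<le> f ((1 - t) *\<^sub>R x + t *\<^sub>R y)" by (simp add: z_def)
qed simp

text \<open>
  A supergradient at \<open>x0\<close> bounds the increments of a concave function between any point and a
  point farther out on the same side, as slopes decrease from left to right. On the left of
  \<open>x0\<close> the factor \<open>t - s\<close> is negative, so there the inequality bounds the slope from below.
\<close>

lemma concave_on_increment_le:
  fixes f :: "real \<Rightarrow> real"
  assumes f: "concave_on S f" and p: "f t \<le> f x0 + p * (t - x0)"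
    and mem: "x0 \<in> S" "t \<in> S" and st: "x0 \<le> s \<and> s \<le> t \<or> t \<le> s \<and> s \<le> x0"
  shows "f t - f s \<le> p * (t - s)"
proof (cases "x0 = t")
  case False
  define l where "l = (s - x0) / (t - x0)"
  have l: "0 \<le> l" "l \<le> 1" using st False by (auto simp: l_def divide_simps)
  have "l * (t - x0) = s - x0" using False by (simp add: l_def)
  then have s: "s = (1 - l) * x0 + l * t" by (simp add: algebra_simps)
  have "(1 - l) * f x0 + l * f t \<le> f s"
    using concave_onD[OF f l mem] s by simp
  moreover have "(1 - l) * (f t - p * (t - x0)) \<le> (1 - l) * f x0"
    using l p by (intro mult_left_mono) auto
  moreover have "(1 - l) * (t - x0) = t - s" using s by (simp add: algebra_simps)
  then have "(1 - l) * (f t - p * (t - x0)) = (1 - l) * f t - p * (t - s)"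
    by (metis right_diff_distrib mult.left_commute)
  ultimately show ?thesis by (simp add: algebra_simps)
qed (use st in auto)

text \<open>
  In the variable \<open>y = R(t)\<close> the function \<open>F\<close> has derivative
  \<open>\<phi>(f(t)) f'(t) / w(t) = c f'(t)\<close>, so its slopes are monotone because those of
  \<open>f\<close> are. Precisely, \<open>c\<close> times a supergradient of \<open>f\<close> at \<open>x0\<close> is one of
  \<open>F\<close> at \<open>R(x0)\<close>. The case \<open>\<Phi>(z) = z\<^sup>2\<close> serves the direct transport and
  \<open>\<Phi>(z) = \<surd>z\<close> the inverse one.
\<close>

lemma concave_on_reparam:
  fixes f F R \<Phi> \<phi> :: "real \<Rightarrow> real"
  assumes f: "concave_on {0..1} f" "continuous_on {0..1} f"
    and R: "unit_reparam R w" and w: "\<And>t. t \<in> {0<..<1} \<Longrightarrow> c * w t = \<phi> (f t)"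
    and \<phi>c: "continuous_on {0<..<1} (\<lambda>t. \<phi> (f t))"
    and nn: "\<And>t. t \<in> {0<..<1} \<Longrightarrow> 0 \<le> \<phi> (f t)"
    and \<Phi>: "\<And>t. t \<in> {0<..<1} \<Longrightarrow> (\<Phi> has_real_derivative \<phi> (f t)) (at (f t))"
    and Fc: "continuous_on {0..1} F" and F: "\<And>t. t \<in> {0<..<1} \<Longrightarrow> F (R t) = \<Phi> (f t)"
  shows "concave_on {0..1} F"
proof (rule concave_on_if_supergradients[OF Fc])
  fix y0 :: real assume y0: "y0 \<in> {0<..<1}"
  have R1: "R ` {0<..<1} = {0<..<1}"
    using unit_reparam_image(2)[OF R, of 1] R by (simp add: unit_reparam_def)
  obtain x0 where x0: "x0 \<in> {0<..<1}" "y0 = R x0" using y0 R1 by (metis imageE)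
  obtain p where p: "\<And>x. x \<in> {0..1} \<Longrightarrow> f x \<le> f x0 + p * (x - x0)"
    using concave_on_supergradient[OF f(1) x0(1)] by blast
  have I: "((\<lambda>x. c * R x) has_real_derivative \<phi> (f t)) (at t)" if "t \<in> {0<..<1}" for t
    using DERIV_cmult[of R "w t" t UNIV c] R that w by (auto simp: unit_reparam_def)
  have key: "\<Phi> (f x) - \<Phi> (f x0) \<le> p * (c * R x - c * R x0)" if x: "x \<in> {0<..<1}" for x
  proof (cases "x0 \<le> x")
    case True
    have sub: "{x0..x} \<subseteq> {0<..<1}" using x x0 by auto
    show ?thesis
    proof (rule increment_le_of_chain_rule[OF True, where f=f and \<Phi>=\<Phi> and \<phi>=\<phi> and I="\<lambda>x. c * R x"])
      show "continuous_on {x0..x} f" by (rule continuous_on_subset[OF f(2)]) (use sub in auto)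
      show "continuous_on {x0..x} (\<lambda>t. \<phi> (f t))" by (rule continuous_on_subset[OF \<phi>c sub])
      show "f t - f s \<le> p * (t - s)" if "x0 \<le> s" "s \<le> t" "t \<le> x" for s t
        using that sub x x0 by (intro concave_on_increment_le[OF f(1) p]) auto
    qed (use sub I \<Phi> nn in auto)
  next
    case False
    then have le: "x \<le> x0" by simp
    have sub: "{x..x0} \<subseteq> {0<..<1}" using x x0 by auto
    \<comment> \<open>To the left of \<open>x0\<close> the increments of \<open>f\<close> are bounded from below, so the comparison
      is applied to \<open>-f\<close> with slope \<open>-p\<close>.\<close>
    have "(\<lambda>z. - \<Phi> (- z)) (- f x0) - (\<lambda>z. - \<Phi> (- z)) (- f x) \<le> (- p) * (c * R x0 - c * R x)"
    proof (rule increment_le_of_chain_rule[OF le, where f="\<lambda>t. - f t" and \<phi>="\<lambda>z. \<phi> (- z)"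
        and \<Phi>="\<lambda>z. - \<Phi> (- z)" and I="\<lambda>x. c * R x"])
      show "continuous_on {x..x0} (\<lambda>t. - f t)"
        by (intro continuous_intros continuous_on_subset[OF f(2)]) (use sub in auto)
      show "continuous_on {x..x0} (\<lambda>t. \<phi> (- (- f t)))" using continuous_on_subset[OF \<phi>c sub] by simp
      show "- f t - - f s \<le> - p * (t - s)" if "x \<le> s" "s \<le> t" "t \<le> x0" for s t
      proof -
        have "f s - f t \<le> p * (s - t)"
          using that sub x x0 by (intro concave_on_increment_le[OF f(1) p]) auto
        then show ?thesis by (simp add: algebra_simps)
      qed
      show "((\<lambda>z. - \<Phi> (- z)) has_real_derivative \<phi> (- (- f t))) (at (- f t))" if "t \<in> {x..x0}" for t
      proof -
        have "(\<Phi> has_real_derivative \<phi> (f t)) (at (- (- f t)))" using \<Phi> sub that by auto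
        from DERIV_chain2[where f=\<Phi> and g=uminus, OF this DERIV_minus[OF DERIV_ident]]
        have "((\<lambda>z. \<Phi> (- z)) has_real_derivative - \<phi> (f t)) (at (- f t))" by simp
        from DERIV_minus[OF this] show ?thesis by simp
      qed
    qed (use sub I nn in auto)
    then show ?thesis by (simp add: algebra_simps)
  qed
  have "F y \<le> F y0 + (p * c) * (y - y0)" if "y \<in> {0<..<1}" for y
  proof -
    obtain x where x: "x \<in> {0<..<1}" "y = R x" using \<open>y \<in> {0<..<1}\<close> R1 by (metis imageE)
    show ?thesis using key[OF x(1)] F x x0 by (simp add: algebra_simps)
  qed
  then show "\<exists>p. \<forall>x\<in>{0<..<1}. F x \<le> F y0 + p * (x - y0)" by blast
qed

section \<open>The bijection between weights\<close>

lemma concave_weights_pos: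
  assumes h: "h \<in> concave_weights" and x: "x \<in> {0<..<1}"
  shows "0 < h x"
proof -
  have conc: "concave_on {0..1} h" and nn: "\<And>x. x \<in> {0..1} \<Longrightarrow> 0 \<le> h x"
    using h by (auto simp: concave_weights_def)
  obtain z where z: "z \<in> {0..1}" "h z \<noteq> 0" using h by (auto simp: concave_weights_def)
  then have hz: "0 < h z" using nn[OF z(1)] by simp
  \<comment> \<open>Positivity at \<open>z\<close> spreads along the segments from \<open>z\<close> to the endpoints;
    \<open>x\<close> lies on the one that ends in \<open>e\<close>.\<close>
  define e :: real where "e = (if x \<le> z then 0 else 1)"
  define l where "l = (x - e) / (z - e)"
  have ze: "z \<noteq> e" using x z by (auto simp: e_def)
  have l: "0 < l" "l \<le> 1" using x z by (auto simp: l_def e_def divide_simps)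
  have "l * (z - e) = x - e" using ze by (simp add: l_def)
  then have xl: "x = (1 - l) * e + l * z" by (simp add: algebra_simps)
  have "e \<in> {0..1}" by (simp add: e_def)
  then have "(1 - l) * h e + l * h z \<le> h x" "0 \<le> (1 - l) * h e"
    using concave_onD[OF conc _ l(2), of e z] l z nn xl by auto
  with l hz show ?thesis by (smt (verit) mult_pos_pos)
qed

definition normalized_primitive :: "(real \<Rightarrow> real) \<Rightarrow> real \<Rightarrow> real"
  where "normalized_primitive f x = integral {0..x} f / integral {0..1} f"

lemma integral_unit_pos:
  fixes f :: "real \<Rightarrow> real"
  assumes "integrable unit_leb f" "\<And>x. x \<in> {0<..<1} \<Longrightarrow> 0 < f x"
  shows "0 < integral {0..1} f"
  using LINT_unit_leb_pos[OF assms] LINT_unit_leb_eq_integral[OF assms(1)]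
  by (simp add: integral_open_interval_real)

lemma unit_reparam_normalized_primitive:
  fixes f :: "real \<Rightarrow> real"
  assumes f: "integrable unit_leb f" and pos: "\<And>x. x \<in> {0<..<1} \<Longrightarrow> 0 < f x"
    and cont: "continuous_on {0<..<1} f"
  shows "unit_reparam (normalized_primitive f) (\<lambda>x. f x / integral {0..1} f)"
proof -
  have N: "0 < integral {0..1} f" by (rule integral_unit_pos[OF f pos])
  have int: "f integrable_on {0..1}" by (rule integrable_on_closed_unit[OF f]) auto
  have "continuous_on {0..1} (normalized_primitive f)"
    unfolding normalized_primitive_def
    using N by (intro continuous_intros indefinite_integral_continuous_1[OF int]) auto
  moreover have "(normalized_primitive f has_real_derivative f x / integral {0..1} f) (at x)"
    if x: "x \<in> {0<..<1}" for x
  proof -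
    have "isCont f x" using cont x by (simp add: continuous_on_eq_continuous_at)
    then have "continuous (at x within {0..1}) f" by (rule continuous_at_imp_continuous_at_within)
    then have "((\<lambda>u. integral {0..u} f) has_vector_derivative f x) (at x within {0..1})"
      using integral_has_vector_derivative_continuous_at[OF int, of x "{}"] x by simp
    moreover have "at x within {0..1} = at x" using x by (intro at_within_interior) auto
    ultimately have "((\<lambda>u. integral {0..u} f) has_real_derivative f x) (at x)"
      by (simp add: has_real_derivative_iff_has_vector_derivative)
    then show ?thesis
      unfolding normalized_primitive_def[abs_def] by (rule DERIV_cdivide)
  qed
  ultimately show ?thesis
    using N pos by (auto simp: unit_reparam_def normalized_primitive_def)
qed

lemma unit_reparam_inverse:
  fixes H :: "real \<Rightarrow> real"
  assumes H: "unit_reparam H w"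
  defines "X \<equiv> the_inv_into {0..1} H"
  shows "unit_reparam X (\<lambda>y. 1 / w (X y))"
    and "\<And>x. x \<in> {0..1} \<Longrightarrow> X (H x) = x" and "\<And>y. y \<in> {0..1} \<Longrightarrow> H (X y) = y"
    and "\<And>y. y \<in> {0..1} \<Longrightarrow> X y \<in> {0..1}" and "\<And>y. y \<in> {0<..<1} \<Longrightarrow> X y \<in> {0<..<1}"
proof -
  note inj = unit_reparam_inj_on[OF H]
  have H01: "H 0 = 0" "H 1 = 1" and Hc: "continuous_on {0..1} H" using H by (auto simp: unit_reparam_def)
  have im: "H ` {0..1} = {0..1}" "H ` {0<..<1} = {0<..<1}"
    using unit_reparam_image[OF H, of 1] H01 by auto
  show XH: "X (H x) = x" if "x \<in> {0..1}" for x
    unfolding X_def by (rule the_inv_into_f_f[OF inj that])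
  show HX: "H (X y) = y" if "y \<in> {0..1}" for y
    unfolding X_def by (rule f_the_inv_into_f[OF inj]) (use that im in simp)
  show "X y \<in> {0..1}" if "y \<in> {0..1}" for y
    unfolding X_def by (rule the_inv_into_into[OF inj]) (use that im in simp_all)
  show Xin: "X y \<in> {0<..<1}" if "y \<in> {0<..<1}" for y
  proof -
    have "y \<in> H ` {0<..<1}" using that im(2) by simp
    then obtain x where "x \<in> {0<..<1}" "y = H x" by (elim imageE)
    then show ?thesis using XH[of x] by simp
  qed
  have "continuous_on (H ` {0..1}) X"
    by (rule continuous_on_inv[OF Hc]) (use XH in auto)
  then have Xc: "continuous_on {0..1} X" by (simp add: im)
  have X01: "X 0 = 0" "X 1 = 1" using XH[of 0] XH[of 1] H01 by auto
  have wpos: "0 < w (X y)" if "y \<in> {0<..<1}" for y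
    using H Xin[OF that] unfolding unit_reparam_def by blast
  have "(X has_real_derivative 1 / w (X y)) (at y)" if y: "y \<in> {0<..<1}" for y
  proof -
    have "(X has_real_derivative inverse (w (X y))) (at y)"
    proof (rule DERIV_inverse_function[where a=0 and b=1])
      show "(H has_real_derivative w (X y)) (at (X y))"
        using H Xin[OF y] unfolding unit_reparam_def by blast
      show "w (X y) \<noteq> 0" using wpos[OF y] by simp
      show "isCont X y"
        by (rule continuous_on_interior[OF Xc]) (use y in simp)
    qed (use y HX in auto)
    then show ?thesis by (simp add: inverse_eq_divide)
  qed
  then show "unit_reparam X (\<lambda>y. 1 / w (X y))"
    using Xc X01 wpos by (simp add: unit_reparam_def)
qed

definition transported_weight :: "(real \<Rightarrow> real) \<Rightarrow> real \<Rightarrow> real"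
  where "transported_weight h =
    restrict (\<lambda>y. (h (the_inv_into {0..1} (normalized_primitive h) y))\<^sup>2) {0..1}"

definition untransported_weight :: "(real \<Rightarrow> real) \<Rightarrow> real \<Rightarrow> real"
  where "untransported_weight k =
    restrict (\<lambda>x. sqrt (k (the_inv_into {0..1} (normalized_primitive (\<lambda>y. 1 / sqrt (k y))) x))) {0..1}"

lemma concave_weightsD:
  assumes "h \<in> concave_weights"
  shows "continuous_on {0..1} h" "concave_on {0..1} h" "\<And>x. x \<in> {0..1} \<Longrightarrow> 0 \<le> h x"
    "h \<in> extensional {0..1}" "integrable unit_leb h" "0 < integral {0..1} h"
    "unit_reparam (normalized_primitive h) (\<lambda>x. h x / integral {0..1} h)"
proof -
  show c: "continuous_on {0..1} h" "concave_on {0..1} h" "\<And>x. x \<in> {0..1} \<Longrightarrow> 0 \<le> h x"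
    "h \<in> extensional {0..1}"
    using assms by (auto simp: concave_weights_def)
  show i: "integrable unit_leb h" by (rule integrable_unit_leb_continuous[OF c(1)])
  show "0 < integral {0..1} h" by (rule integral_unit_pos[OF i concave_weights_pos[OF assms]])
  show "unit_reparam (normalized_primitive h) (\<lambda>x. h x / integral {0..1} h)"
    by (rule unit_reparam_normalized_primitive[OF i concave_weights_pos[OF assms]])
       (auto intro: continuous_on_subset[OF c(1)])
qed

lemma concave_weightsI:
  assumes "continuous_on {0..1} f" "concave_on {0..1} f" "\<And>x. x \<in> {0..1} \<Longrightarrow> 0 \<le> f x"
    and "0 < f (1 / 2)" "f \<in> extensional {0..1}"
  shows "f \<in> concave_weights"
  using assms by (auto simp: concave_weights_def intro!: bexI[of _ "1 / 2"])

lemma transported_weight_props: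
  assumes h: "h \<in> concave_weights"
  shows "transported_weight h \<in> concave_weights"
    and "weight_transport (integral {0..1} h) (normalized_primitive h) h (transported_weight h)"
proof -
  define M where "M = integral {0..1} h"
  define H where "H = normalized_primitive h"
  define X where "X = the_inv_into {0..1} H"
  define k where "k = transported_weight h"
  note hs = concave_weightsD[OF h]
  have M: "0 < M" and H: "unit_reparam H (\<lambda>x. h x / M)" using hs by (auto simp: M_def H_def)
  note X = unit_reparam_inverse[OF H, folded X_def]
  have k: "k y = (h (X y))\<^sup>2" if "y \<in> {0..1}" for y
    using that by (simp add: k_def transported_weight_def X_def H_def)
  have Him: "H x \<in> {0..1}" if "x \<in> {0..1}" for x
    using unit_reparam_image(1)[OF H, of 1] H that by (auto simp: unit_reparam_def)
  have kH: "k (H x) = (h x)\<^sup>2" if "x \<in> {0..1}" for x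
    using k[OF Him[OF that]] X(2)[OF that] by simp
  have Xc: "continuous_on {0..1} X" using X(1) by (simp add: unit_reparam_def)
  have "continuous_on {0..1} (\<lambda>y. (h (X y))\<^sup>2)"
    by (intro continuous_on_power continuous_on_compose2[OF hs(1) Xc]) (use X(4) in blast)
  then have kc: "continuous_on {0..1} k"
    by (rule continuous_on_eq) (simp add: k)
  have "concave_on {0..1} k"
  proof (rule concave_on_reparam[OF hs(2,1) H, where c="2 * M" and \<phi>="\<lambda>z. 2 * z" and \<Phi>="\<lambda>z. z\<^sup>2"])
    show "continuous_on {0<..<1} (\<lambda>t. 2 * h t)"
      by (intro continuous_intros continuous_on_subset[OF hs(1)]) auto
    show "((\<lambda>z. z\<^sup>2) has_real_derivative 2 * h t) (at (h t))" for t
      by (auto intro!: derivative_eq_intros)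
  qed (use M hs(3) kc kH in auto)
  moreover have "0 < k (1 / 2)"
    using k[of "1/2"] concave_weights_pos[OF h X(5)[of "1/2"]] by simp
  moreover have "k \<in> extensional {0..1}" by (simp add: k_def transported_weight_def)
  ultimately show "transported_weight h \<in> concave_weights"
    unfolding k_def[symmetric] by (intro concave_weightsI kc) (use k in auto)
  show "weight_transport (integral {0..1} h) (normalized_primitive h) h (transported_weight h)"
    using M H hs(1) kc kH by (auto simp: weight_transport_def M_def H_def k_def)
qed

text \<open>
  In the variable \<open>x\<close> the integrand \<open>1 / \<surd>k\<close> becomes \<open>(1 / h) (h / M)\<close>, the constant \<open>1 / M\<close>.
  Hence the normalised primitive of \<open>1 / \<surd>k\<close> inverts that of \<open>h\<close>, and its total integral
  is \<open>1 / M\<close>.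
\<close>

lemma inverse_sqrt_transported_weight:
  assumes h: "h \<in> concave_weights"
  defines "f \<equiv> \<lambda>y. 1 / sqrt (transported_weight h y)"
  shows "integrable unit_leb f" "x \<in> {0..1} \<Longrightarrow> integral {0..normalized_primitive h x} f = x / integral {0..1} h"
proof -
  define M where "M = integral {0..1} h"
  define H where "H = normalized_primitive h"
  note hs = concave_weightsD[OF h]
  have M: "0 < M" and H: "unit_reparam H (\<lambda>x. h x / M)" using hs by (auto simp: M_def H_def)
  have k: "transported_weight h (H x) = (h x)\<^sup>2" if "x \<in> {0..1}" for x
    using transported_weight_props(2)[OF h] that by (auto simp: weight_transport_def H_def)
  have eq: "h x / M * f (H x) = 1 / M" if "x \<in> {0<..<1}" for x
    using concave_weights_pos[OF h that] that by (simp add: f_def k)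
  have "integrable unit_leb (\<lambda>x. h x / M * f (H x)) \<longleftrightarrow> integrable unit_leb (\<lambda>x. 1 / M)"
    by (intro Bochner_Integration.integrable_cong refl) (use eq in auto)
  then show i: "integrable unit_leb f"
    using unit_reparam_integrable_iff[OF H, of f] integrable_unit_leb_continuous[OF continuous_on_const] by simp
  show "integral {0..normalized_primitive h x} f = x / integral {0..1} h" if x: "x \<in> {0..1}"
  proof -
    have "integral {0..H x} f = integral {0..x} (\<lambda>t. h t / M * f (H t))"
      by (rule unit_reparam_primitive[OF H i, symmetric]) (use x in auto)
    also have "\<dots> = integral {0..x} (\<lambda>t. 1 / M)"
      by (rule integral_spike[of "{0, 1}"]) (use eq x in auto)
    also have "\<dots> = x / M" using x by simp
    finally show ?thesis by (simp add: M_def H_def)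
  qed
qed

lemma untransported_transported_weight:
  assumes h: "h \<in> concave_weights"
  shows "untransported_weight (transported_weight h) = h"
proof
  fix x
  define k where "k = transported_weight h"
  define f where "f = (\<lambda>y. 1 / sqrt (k y))"
  define H where "H = normalized_primitive h"
  note hs = concave_weightsD[OF h]
  have f: "integrable unit_leb f" "\<And>x. x \<in> {0..1} \<Longrightarrow> integral {0..H x} f = x / integral {0..1} h"
    unfolding f_def k_def H_def by (fact inverse_sqrt_transported_weight[OF h])+
  have kP: "k \<in> concave_weights" unfolding k_def by (rule transported_weight_props(1)[OF h])
  have tr: "weight_transport (integral {0..1} h) H h k"
    unfolding k_def H_def by (rule transported_weight_props(2)[OF h])
  show "untransported_weight k x = h x"
  proof (cases "x \<in> {0..1}")
    case True
    have H1: "H 1 = 1" using hs(7) by (simp add: unit_reparam_def H_def)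
    have K: "unit_reparam (normalized_primitive f) (\<lambda>x. f x / integral {0..1} f)"
    proof (rule unit_reparam_normalized_primitive[OF f(1)])
      show "0 < f y" if "y \<in> {0<..<1}" for y
        using concave_weights_pos[OF kP that] by (simp add: f_def)
      show "continuous_on {0<..<1} f"
        unfolding f_def using concave_weights_pos[OF kP]
        by (intro continuous_intros continuous_on_subset[OF concave_weightsD(1)[OF kP]]) force+
    qed
    have "normalized_primitive f (H x) = x"
      using f(2)[OF True] f(2)[of 1] hs(6) H1 by (simp add: normalized_primitive_def)
    then have "the_inv_into {0..1} (normalized_primitive f) x = H x"
      by (intro the_inv_into_f_eq[OF unit_reparam_inj_on[OF K]] weight_transport_pos(4)[OF tr True])
    then have "untransported_weight k x = sqrt (k (H x))"
      using True by (simp add: untransported_weight_def f_def)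
    also have "k (H x) = (h x)\<^sup>2" using tr True by (simp add: weight_transport_def)
    finally show ?thesis using hs(3)[OF True] by simp
  next
    case False
    then show ?thesis
      using extensional_arb[OF hs(4) False]
      by (simp add: untransported_weight_def del: atLeastAtMost_iff)
  qed
qed

text \<open>
  A concave weight lies above a multiple of the distance to the boundary, hence above a multiple of
  \<open>y (1 - y)\<close>, and \<open>1 / \<surd>(y (1 - y))\<close> is the derivative of \<open>arcsin (2 y - 1)\<close>.
\<close>

lemma integrable_inverse_sqrt_concave:
  assumes k: "k \<in> concave_weights"
  shows "integrable unit_leb (\<lambda>y. 1 / sqrt (k y))"
proof -
  note ks = concave_weightsD[OF k]
  define c where "c = 2 * k (1 / 2)"
  have c: "0 < c" using concave_weights_pos[OF k, of "1/2"] by (simp add: c_def)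
  have low: "c * (y * (1 - y)) \<le> k y" if y: "y \<in> {0<..<1}" for y
  proof -
    have "c * min y (1 - y) \<le> k y"
    proof (cases "y \<le> 1 / 2")
      case True
      have "(1 - 2 * y) * k 0 + 2 * y * k (1 / 2) \<le> k y"
        using concave_onD[OF ks(2), of "2 * y" 0 "1/2"] y True by simp
      moreover have "0 \<le> (1 - 2 * y) * k 0" using True ks(3)[of 0] by simp
      ultimately show ?thesis using True by (simp add: c_def min_def mult_ac)
    next
      case False
      have "(1 - (2 - 2 * y)) * k 1 + (2 - 2 * y) * k (1 / 2) \<le> k y"
        using concave_onD[OF ks(2), of "2 - 2 * y" 1 "1/2"] y False by (simp add: field_simps)
      moreover have "0 \<le> (1 - (2 - 2 * y)) * k 1" using False ks(3)[of 1] by simp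
      ultimately show ?thesis using False by (simp add: c_def min_def algebra_simps)
    qed
    moreover have "y * (1 - y) \<le> min y (1 - y)" using y by (auto simp: min_def mult_left_le mult_left_le_one_le)
    ultimately show ?thesis using c by (smt (verit) mult_left_mono)
  qed
  have "((\<lambda>y. 1 / sqrt (y * (1 - y))) has_integral arcsin (2 * 1 - 1) - arcsin (2 * 0 - 1)) {0..1::real}"
  proof (rule fundamental_theorem_of_calculus_interior)
    show "continuous_on {0..1} (\<lambda>y. arcsin (2 * y - 1) :: real)" by (intro continuous_intros) auto
    fix y :: real assume y: "y \<in> {0<..<1}"
    have sq: "1 - (2 * y - 1)\<^sup>2 = 4 * (y * (1 - y))" by (simp add: power2_eq_square algebra_simps)
    have "((\<lambda>y. arcsin (2 * y - 1)) has_real_derivative inverse (sqrt (1 - (2 * y - 1)\<^sup>2)) * 2) (at y)"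
      by (rule DERIV_chain2[OF DERIV_arcsin]) (use y in \<open>auto intro!: derivative_eq_intros\<close>)
    then show "((\<lambda>y. arcsin (2 * y - 1)) has_vector_derivative 1 / sqrt (y * (1 - y))) (at y)"
      unfolding sq by (simp add: has_real_derivative_iff_has_vector_derivative real_sqrt_mult inverse_eq_divide)
  qed simp
  then have "(\<lambda>y. 1 / sqrt (y * (1 - y))) integrable_on {0<..<1::real}"
    by (auto simp: integrable_on_open_interval_real)
  then have maj: "(\<lambda>y. 1 / sqrt c * (1 / sqrt (y * (1 - y)))) integrable_on {0<..<1::real}"
    by (rule integrable_on_mult_right)
  have "(\<lambda>y. 1 / sqrt (k y)) absolutely_integrable_on {0<..<1}"
  proof (rule measurable_bounded_by_integrable_imp_absolutely_integrable[OF _ _ maj])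
    have "continuous_on {0<..<1} (\<lambda>y. 1 / sqrt (k y))"
      using concave_weights_pos[OF k] by (intro continuous_intros continuous_on_subset[OF ks(1)]) force+
    then show "(\<lambda>y. 1 / sqrt (k y)) \<in> borel_measurable unit_leb"
      by (rule continuous_imp_measurable_on_sets_lebesgue) simp
    fix y :: real assume y: "y \<in> {0<..<1}"
    have "0 < c * (y * (1 - y))" using c y by simp
    then have "1 / sqrt (k y) \<le> 1 / sqrt (c * (y * (1 - y)))"
      using low[OF y] by (intro divide_left_mono) auto
    then show "norm (1 / sqrt (k y)) \<le> 1 / sqrt c * (1 / sqrt (y * (1 - y)))"
      using concave_weights_pos[OF k y] by (simp add: real_sqrt_mult)
  qed simp
  then show ?thesis by (simp add: integrable_unit_leb_iff)
qed

text \<open>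
  Let \<open>Y\<close> be the inverse of the normalised primitive \<open>K\<close> of \<open>1 / \<surd>k\<close>. Then
  \<open>Y' = N \<surd>(k \<circ> Y) = N h\<close>, so \<open>Y\<close> is the normalised primitive of \<open>h\<close>, and transporting
  \<open>h\<close> composes \<open>h\<^sup>2 = k \<circ> Y\<close> with \<open>K\<close>, which gives back \<open>k\<close>.
\<close>

lemma untransported_weight_props:
  assumes k: "k \<in> concave_weights"
  shows "untransported_weight k \<in> concave_weights" "transported_weight (untransported_weight k) = k"
proof -
  note ks = concave_weightsD[OF k]
  define f where "f = (\<lambda>y. 1 / sqrt (k y))"
  define N where "N = integral {0..1} f"
  define K where "K = normalized_primitive f"
  define Y where "Y = the_inv_into {0..1} K"
  define h where "h = untransported_weight k"
  have fi: "integrable unit_leb f" unfolding f_def by (rule integrable_inverse_sqrt_concave[OF k])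
  have fpos: "0 < f y" if "y \<in> {0<..<1}" for y using concave_weights_pos[OF k that] by (simp add: f_def)
  have fc: "continuous_on {0<..<1} f"
    unfolding f_def using concave_weights_pos[OF k]
    by (intro continuous_intros continuous_on_subset[OF ks(1)]) force+
  have N: "0 < N" unfolding N_def by (rule integral_unit_pos[OF fi fpos])
  have K: "unit_reparam K (\<lambda>y. f y / N)"
    unfolding K_def N_def by (rule unit_reparam_normalized_primitive[OF fi fpos fc])
  note Y = unit_reparam_inverse[OF K, folded Y_def]
  have h: "h x = sqrt (k (Y x))" if "x \<in> {0..1}" for x
    using that by (simp add: h_def untransported_weight_def Y_def K_def f_def)
  have Kim: "K y \<in> {0..1}" if "y \<in> {0..1}" for y
    using unit_reparam_image(1)[OF K, of 1] K that by (auto simp: unit_reparam_def)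
  have hK: "h (K y) = sqrt (k y)" if "y \<in> {0..1}" for y
    using h[OF Kim[OF that]] Y(2)[OF that] by simp
  have Yc: "continuous_on {0..1} Y" using Y(1) by (simp add: unit_reparam_def)
  have "continuous_on {0..1} (\<lambda>x. sqrt (k (Y x)))"
    by (intro continuous_on_real_sqrt continuous_on_compose2[OF ks(1) Yc]) (use Y(4) in blast)
  then have hc: "continuous_on {0..1} h"
    by (rule continuous_on_eq) (simp add: h)
  have "concave_on {0..1} h"
  proof (rule concave_on_reparam[OF ks(2,1) K, where c="N / 2" and \<phi>="\<lambda>z. 1 / sqrt z / 2" and \<Phi>=sqrt])
    show "continuous_on {0<..<1} (\<lambda>t. 1 / sqrt (k t) / 2)"
      by (rule continuous_on_divide[OF fc[unfolded f_def] continuous_on_const]) simp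
    show "(sqrt has_real_derivative 1 / sqrt (k t) / 2) (at (k t))" if "t \<in> {0<..<1}" for t
      using DERIV_real_sqrt[OF concave_weights_pos[OF k that]] by (simp add: divide_simps)
  qed (use N ks(3) hc hK in \<open>auto simp: f_def\<close>)
  moreover have "0 < h (1 / 2)"
    using h[of "1/2"] concave_weights_pos[OF k Y(5)[of "1/2"]] by simp
  moreover have "0 \<le> h x" if "x \<in> {0..1}" for x using h[OF that] ks(3)[OF Y(4)[OF that]] by simp
  ultimately show hP: "untransported_weight k \<in> concave_weights"
    unfolding h_def[symmetric] using hc
    by (intro concave_weightsI) (auto simp: h_def untransported_weight_def)
  have prim: "integral {0..x} h = Y x / N" if x: "x \<in> {0..1}" for x
  proof -
    have "integral {0..x} (\<lambda>t. 1 / (f (Y t) / N) * 1) = integral {0..Y x} (\<lambda>_. 1)"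
      using unit_reparam_primitive[OF Y(1), of "\<lambda>_. 1" x] x integrable_unit_leb_continuous[OF continuous_on_const]
      by simp
    moreover have "integral {0..x} (\<lambda>t. 1 / (f (Y t) / N) * 1) = integral {0..x} (\<lambda>t. N * h t)"
      by (rule integral_cong) (use x h in \<open>auto simp: f_def\<close>)
    ultimately show ?thesis using N Y(4)[OF x] by (simp add: field_simps)
  qed
  have H: "normalized_primitive h x = Y x" if "x \<in> {0..1}" for x
    using prim[OF that] prim[of 1] N Y(1) by (simp add: normalized_primitive_def unit_reparam_def)
  show "transported_weight (untransported_weight k) = k"
    unfolding h_def[symmetric]
  proof
    fix y
    show "transported_weight h y = k y"
    proof (cases "y \<in> {0..1}")
      case True
      have "inj_on (normalized_primitive h) {0..1}"
        by (rule unit_reparam_inj_on[OF concave_weightsD(7)]) (use hP in \<open>simp add: h_def\<close>)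
      then have "the_inv_into {0..1} (normalized_primitive h) y = K y"
        using H[OF Kim[OF True]] Y(2)[OF True] Kim[OF True] by (intro the_inv_into_f_eq) auto
      then show ?thesis
        using True hK ks(3) by (simp add: transported_weight_def)
    next
      case False
      then show ?thesis
        using extensional_arb[OF ks(4) False]
        by (simp add: transported_weight_def del: atLeastAtMost_iff)
    qed
  qed
qed

theorem theorem1p3:
  "\<exists>G :: (real \<Rightarrow> real) \<Rightarrow> (real \<Rightarrow> real).
     bij_betw G concave_weights concave_weights \<and>
     (\<forall>h\<in>concave_weights. \<forall>k\<in>concave_weights.
        (LINT t|unit_leb. h t)\<^sup>2 * mu1 h = sigma1 (G h) \<and>
        (LINT t|unit_leb. 1 / sqrt (k t))\<^sup>2 * sigma1 k = mu1 (inv_into concave_weights G k))"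
proof (intro exI[of _ transported_weight] conjI ballI)
  show bij: "bij_betw transported_weight concave_weights concave_weights"
    by (rule bij_betw_byWitness[where f'=untransported_weight])
       (use untransported_transported_weight untransported_weight_props transported_weight_props(1) in auto)
  fix h k assume h: "h \<in> concave_weights" and k: "k \<in> concave_weights"
  have LINT: "(LINT t|unit_leb. f t) = integral {0..1} f" if "integrable unit_leb f" for f :: "real \<Rightarrow> real"
    using LINT_unit_leb_eq_integral[OF that] by (simp add: integral_open_interval_real)
  have first: "(LINT t|unit_leb. h t)\<^sup>2 * mu1 h = sigma1 (transported_weight h)"
    if "h \<in> concave_weights" for h
    using transport_eigenvalues[OF transported_weight_props(2)[OF that]]
      LINT[OF concave_weightsD(5)[OF that]] by simp
  show "(LINT t|unit_leb. h t)\<^sup>2 * mu1 h = sigma1 (transported_weight h)" by (rule first[OF h])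
  define g where "g = inv_into concave_weights transported_weight k"
  have "k \<in> transported_weight ` concave_weights" using bij k by (simp add: bij_betw_def)
  then have g: "g \<in> concave_weights" "transported_weight g = k"
    unfolding g_def by (rule inv_into_into, rule f_inv_into_f)
  have "normalized_primitive g 1 = 1"
    using concave_weightsD(7)[OF g(1)] by (simp add: unit_reparam_def)
  then have "(LINT t|unit_leb. 1 / sqrt (k t)) = 1 / (LINT t|unit_leb. g t)"
    using inverse_sqrt_transported_weight(1)[OF g(1)] inverse_sqrt_transported_weight(2)[OF g(1), of 1]
      concave_weightsD(5)[OF g(1)]
    by (simp add: g(2) LINT)
  moreover have "(LINT t|unit_leb. g t) \<noteq> 0"
    using concave_weightsD(5,6)[OF g(1)] by (simp add: LINT)
  moreover have "sigma1 k = (LINT t|unit_leb. g t)\<^sup>2 * mu1 g"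
    using first[OF g(1)] g(2) by simp
  ultimately show "(LINT t|unit_leb. 1 / sqrt (k t))\<^sup>2 * sigma1 k
      = mu1 (inv_into concave_weights transported_weight k)"
    by (simp add: g_def[symmetric] power_divide)
qed

end
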